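(* Every finitely generated metabelian Lie $U$-algebra $A$ over a field $k$ is isomorphic to a subalgebra of the matrix metabelian Lie algebra $M^0_{I,\Lambda}$ for some sets $I$ and $\Lambda$. Conversely, for any sets $I,\Lambda$, every subalgebra of $M^0_{I,\Lambda}$ is a metabelian Lie $U$-algebra.
   Context: All algebras are over a fixed field $k$. A Lie algebra $A$ is metabelian if $(a\circ b)\circ(c\circ d)=0$ for all $a,b,c,d\in A$. $A^2$ denotes the ideal spanned by all products $a\circ b$. The Fitting radical $\mathrm{Fit}(A)$ is the ideal generated by all elements lying in nilpotent ideals of $A$. If $J$ is an abelian ideal of a metabelian Lie algebra $A$ with $A^2\subseteq J$, choose a family $\{a_\alpha:\alpha\in\Lambda\}$ of elements of $A$ whose images form a basis of $A/J$ and let $R=k[x_\alpha:\alpha\in\Lambda]$ be the commutative polynomial ring; $J$ becomes an $R$-module via $b\cdot x_\alpha=b\circ a_\alpha$ ($b\in J$), extended multiplicatively and $k$-linearly (well defined; another choice of family changes the variables by an invertible linear substitution). A metabelian Lie algebra $A$ is a (metabelian Lie) $U$-algebra if $\mathrm{Fit}(A)$ is abelian and $\mathrm{Fit}(A)$, with this $R$-module structure (taking $J=\mathrm{Fit}(A)$), is torsion-free. Matrix algebras: for sets $I,\Lambda$ let $R=k[x_\alpha:\alpha\in\Lambda]$ and $T$ the free $R$-module with basis $\{u_i:i\in I\}$; $M_{I,\Lambda}$ is the set of pairs $(f,u)$, $f\in R$, $u\in T$ (matrices $\begin{pmatrix} f&u\\0&0\end{pmatrix}$), with componentwise addition and scalar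 multiplication and product $(f,u)\circ(g,v)=(0,\,u g-v f)$; it is a metabelian Lie $k$-algebra. $M^0_{I,\Lambda}$ is the subalgebra of all $(f,u)$ with $f$ a $k$-linear combination of the variables $x_\alpha$ (possibly $f=0$). $\Lambda=\emptyset$ is allowed (then $R=k$). *)

theory Defs
  imports Complex_Main "HOL-Library.Poly_Mapping" "HOL-Library.Product_Plus"
begin

definition lie_algebra :: "('k::field \<Rightarrow> 'a::ab_group_add \<Rightarrow> 'a) \<Rightarrow> ('a \<Rightarrow> 'a \<Rightarrow> 'a) \<Rightarrow> 'a set \<Rightarrow> bool" where
  "lie_algebra sc br A \<longleftrightarrow> vector_space sc \<and> module.subspace sc A
     \<and> (\<forall>x\<in>A. \<forall>y\<in>A. br x y \<in> A)
     \<and> (\<forall>x\<in>A. \<forall>y\<in>A. \<forall>z\<in>A. br (x + y) z = br x z + br y z \<and> br z (x + y) = br z x + br z y)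
     \<and> (\<forall>c. \<forall>x\<in>A. \<forall>y\<in>A. br (sc c x) y = sc c (br x y) \<and> br x (sc c y) = sc c (br x y))
     \<and> (\<forall>x\<in>A. br x x = 0)
     \<and> (\<forall>x\<in>A. \<forall>y\<in>A. \<forall>z\<in>A. br x (br y z) + br y (br z x) + br z (br x y) = 0)"

definition lie_subalgebra :: "('k::field \<Rightarrow> 'a::ab_group_add \<Rightarrow> 'a) \<Rightarrow> ('a \<Rightarrow> 'a \<Rightarrow> 'a) \<Rightarrow> 'a set \<Rightarrow> 'a set \<Rightarrow> bool" where
  "lie_subalgebra sc br A T \<longleftrightarrow> T \<subseteq> A \<and> module.subspace sc T \<and> (\<forall>x\<in>T. \<forall>y\<in>T. br x y \<in> T)"

definition lie_ideal :: "('k::field \<Rightarrow> 'a::ab_group_add \<Rightarrow> 'a) \<Rightarrow> ('a \<Rightarrow> 'a \<Rightarrow> 'a) \<Rightarrow> 'a set \<Rightarrow> 'a set \<Rightarrow> bool" where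
  "lie_ideal sc br A J \<longleftrightarrow> J \<subseteq> A \<and> module.subspace sc J \<and> (\<forall>x\<in>J. \<forall>a\<in>A. br x a \<in> J)"

definition lie_generated :: "('k::field \<Rightarrow> 'a::ab_group_add \<Rightarrow> 'a) \<Rightarrow> ('a \<Rightarrow> 'a \<Rightarrow> 'a) \<Rightarrow> 'a set \<Rightarrow> 'a set \<Rightarrow> 'a set" where
  "lie_generated sc br A X = \<Inter>{T. lie_subalgebra sc br A T \<and> X \<subseteq> T}"

definition finitely_generated :: "('k::field \<Rightarrow> 'a::ab_group_add \<Rightarrow> 'a) \<Rightarrow> ('a \<Rightarrow> 'a \<Rightarrow> 'a) \<Rightarrow> 'a set \<Rightarrow> bool" where
  "finitely_generated sc br A \<longleftrightarrow> (\<exists>X. finite X \<and> X \<subseteq> A \<and> lie_generated sc br A X = A)"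

definition bracket_span :: "('k::field \<Rightarrow> 'a::ab_group_add \<Rightarrow> 'a) \<Rightarrow> ('a \<Rightarrow> 'a \<Rightarrow> 'a) \<Rightarrow> 'a set \<Rightarrow> 'a set \<Rightarrow> 'a set" where
  "bracket_span sc br X Y = module.span sc {br x y | x y. x \<in> X \<and> y \<in> Y}"

primrec lower_central :: "('k::field \<Rightarrow> 'a::ab_group_add \<Rightarrow> 'a) \<Rightarrow> ('a \<Rightarrow> 'a \<Rightarrow> 'a) \<Rightarrow> 'a set \<Rightarrow> nat \<Rightarrow> 'a set" where
  "lower_central sc br J 0 = J"
| "lower_central sc br J (Suc n) = bracket_span sc br (lower_central sc br J n) J"

definition nilpotent_ideal :: "('k::field \<Rightarrow> 'a::ab_group_add \<Rightarrow> 'a) \<Rightarrow> ('a \<Rightarrow> 'a \<Rightarrow> 'a) \<Rightarrow> 'a set \<Rightarrow> 'a set \<Rightarrow> bool" where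
  "nilpotent_ideal sc br A J \<longleftrightarrow> lie_ideal sc br A J \<and> (\<exists>n. lower_central sc br J n = {0})"

definition fitting :: "('k::field \<Rightarrow> 'a::ab_group_add \<Rightarrow> 'a) \<Rightarrow> ('a \<Rightarrow> 'a \<Rightarrow> 'a) \<Rightarrow> 'a set \<Rightarrow> 'a set" where
  "fitting sc br A = \<Inter>{I. lie_ideal sc br A I \<and> \<Union>{J. nilpotent_ideal sc br A J} \<subseteq> I}"

definition metabelian :: "('k::field \<Rightarrow> 'a::ab_group_add \<Rightarrow> 'a) \<Rightarrow> ('a \<Rightarrow> 'a \<Rightarrow> 'a) \<Rightarrow> 'a set \<Rightarrow> bool" where
  "metabelian sc br A \<longleftrightarrow> lie_algebra sc br A
     \<and> (\<forall>a\<in>A. \<forall>b\<in>A. \<forall>c\<in>A. \<forall>d\<in>A. br (br a b) (br c d) = 0)"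

definition abelian_set :: "('a \<Rightarrow> 'a \<Rightarrow> 'a::zero) \<Rightarrow> 'a set \<Rightarrow> bool" where
  "abelian_set br J \<longleftrightarrow> (\<forall>x\<in>J. \<forall>y\<in>J. br x y = 0)"

type_synonym ('v, 'k) mpoly = "('v \<Rightarrow>\<^sub>0 nat) \<Rightarrow>\<^sub>0 'k"

definition polys_in :: "'v set \<Rightarrow> ('v, 'k::zero) mpoly set" where
  "polys_in V = {p. \<forall>m\<in>Poly_Mapping.keys p. Poly_Mapping.keys m \<subseteq> V}"

definition pvar :: "'v \<Rightarrow> ('v, 'k::{zero,one}) mpoly" where
  "pvar v = Poly_Mapping.single (Poly_Mapping.single v 1) 1"

definition pconst :: "'k::zero \<Rightarrow> ('v, 'k) mpoly" where
  "pconst c = Poly_Mapping.single 0 c"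

definition quotient_basis :: "('k::field \<Rightarrow> 'a::ab_group_add \<Rightarrow> 'a) \<Rightarrow> 'a set \<Rightarrow> 'a set \<Rightarrow> 'a set \<Rightarrow> bool" where
  "quotient_basis sc A J B \<longleftrightarrow> B \<subseteq> A \<and> A \<subseteq> module.span sc (B \<union> J)
     \<and> (\<forall>B' c. finite B' \<longrightarrow> B' \<subseteq> B \<longrightarrow> (\<Sum>b\<in>B'. sc (c b) b) \<in> J \<longrightarrow> (\<forall>b\<in>B'. c b = 0))"

definition poly_action :: "('k::field \<Rightarrow> 'a::ab_group_add \<Rightarrow> 'a) \<Rightarrow> ('a \<Rightarrow> 'a \<Rightarrow> 'a) \<Rightarrow> 'a set \<Rightarrow> 'a set
      \<Rightarrow> ('a \<Rightarrow> ('a, 'k) mpoly \<Rightarrow> 'a) \<Rightarrow> bool" where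
  "poly_action sc br J B act \<longleftrightarrow>
     (\<forall>v\<in>J. \<forall>f\<in>polys_in B. act v f \<in> J)
   \<and> (\<forall>v\<in>J. act v 1 = v)
   \<and> (\<forall>v\<in>J. \<forall>b\<in>B. act v (pvar b) = br v b)
   \<and> (\<forall>v\<in>J. \<forall>f\<in>polys_in B. \<forall>g\<in>polys_in B. act v (f + g) = act v f + act v g)
   \<and> (\<forall>v\<in>J. \<forall>c. \<forall>f\<in>polys_in B. act v (pconst c * f) = sc c (act v f))
   \<and> (\<forall>v\<in>J. \<forall>w\<in>J. \<forall>f\<in>polys_in B. act (v + w) f = act v f + act w f)
   \<and> (\<forall>v\<in>J. \<forall>c. \<forall>f\<in>polys_in B. act (sc c v) f = sc c (act v f))
   \<and> (\<forall>v\<in>J. \<forall>f\<in>polys_in B. \<forall>g\<in>polys_in B. act v (f * g) = act (act v f) g)"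

definition torsion_free_action :: "'a::zero set \<Rightarrow> 'a set \<Rightarrow> ('a \<Rightarrow> ('a, 'k::zero) mpoly \<Rightarrow> 'a) \<Rightarrow> bool" where
  "torsion_free_action J B act \<longleftrightarrow> (\<forall>v\<in>J. \<forall>f\<in>polys_in B. act v f = 0 \<longrightarrow> v = 0 \<or> f = 0)"

text \<open>Metabelian Lie U-algebra. The R-module structure exists, and (it being independent of
  the choices) every such structure is torsion-free.\<close>
definition U_algebra :: "('k::field \<Rightarrow> 'a::ab_group_add \<Rightarrow> 'a) \<Rightarrow> ('a \<Rightarrow> 'a \<Rightarrow> 'a) \<Rightarrow> 'a set \<Rightarrow> bool" where
  "U_algebra sc br A \<longleftrightarrow> metabelian sc br A \<and> abelian_set br (fitting sc br A)
     \<and> (\<exists>B act. quotient_basis sc A (fitting sc br A) B \<and> poly_action sc br (fitting sc br A) B act)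
     \<and> (\<forall>B act. quotient_basis sc A (fitting sc br A) B \<and> poly_action sc br (fitting sc br A) B act
           \<longrightarrow> torsion_free_action (fitting sc br A) B act)"

definition lie_embedding :: "('k::field \<Rightarrow> 'a::ab_group_add \<Rightarrow> 'a) \<Rightarrow> ('a \<Rightarrow> 'a \<Rightarrow> 'a) \<Rightarrow> 'a set
      \<Rightarrow> ('k \<Rightarrow> 'b::ab_group_add \<Rightarrow> 'b) \<Rightarrow> ('b \<Rightarrow> 'b \<Rightarrow> 'b) \<Rightarrow> ('a \<Rightarrow> 'b) \<Rightarrow> bool" where
  "lie_embedding sc1 br1 A sc2 br2 \<phi> \<longleftrightarrow> inj_on \<phi> A
     \<and> (\<forall>x\<in>A. \<forall>y\<in>A. \<phi> (x + y) = \<phi> x + \<phi> y)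
     \<and> (\<forall>c. \<forall>x\<in>A. \<phi> (sc1 c x) = sc2 c (\<phi> x))
     \<and> (\<forall>x\<in>A. \<forall>y\<in>A. \<phi> (br1 x y) = br2 (\<phi> x) (\<phi> y))"

text \<open>(f,u) with f in R = k[x_alpha], u in T = free R-module with basis u_i (i in I),
  represented as finitely supported functions I -> R.\<close>
type_synonym ('i, 'l, 'k) mat_elem = "('l, 'k) mpoly \<times> ('i \<Rightarrow>\<^sub>0 ('l, 'k) mpoly)"

definition mat_scale :: "'k::field \<Rightarrow> ('i, 'l, 'k) mat_elem \<Rightarrow> ('i, 'l, 'k) mat_elem" where
  "mat_scale c p = (pconst c * fst p, Poly_Mapping.map (\<lambda>r. pconst c * r) (snd p))"

definition mat_br :: "('i, 'l, 'k::field) mat_elem \<Rightarrow> ('i, 'l, 'k) mat_elem \<Rightarrow> ('i, 'l, 'k) mat_elem" where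
  "mat_br p q = (0, Poly_Mapping.map (\<lambda>r. r * fst q) (snd p) - Poly_Mapping.map (\<lambda>r. r * fst p) (snd q))"

definition matM :: "'i set \<Rightarrow> 'l set \<Rightarrow> ('i, 'l, 'k::field) mat_elem set" where
  "matM I \<Lambda> = {p. fst p \<in> polys_in \<Lambda> \<and> Poly_Mapping.keys (snd p) \<subseteq> I
                  \<and> (\<forall>i. Poly_Mapping.lookup (snd p) i \<in> polys_in \<Lambda>)}"

definition matM0 :: "'i set \<Rightarrow> 'l set \<Rightarrow> ('i, 'l, 'k::field) mat_elem set" where
  "matM0 I \<Lambda> = {p \<in> matM I \<Lambda>. \<forall>m\<in>Poly_Mapping.keys (fst p). \<exists>\<alpha>\<in>\<Lambda>. m = Poly_Mapping.single \<alpha> 1}"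

end

theory Submission
  imports Defs
begin

text \<open>
  A subalgebra \<open>T\<close> of the matrix algebra has the abelian ideal of matrices with vanishing upper left
  entry. If this ideal is zero then \<open>T\<close> is abelian; otherwise it is the Fitting radical, and a
  polynomial \<open>f\<close> in the elements of a basis of the quotient acts on it as multiplication by the
  polynomial obtained by substituting upper left entries. These are linearly independent linear
  forms, so the substitution is injective and the action torsion-free.

  Conversely, let \<open>F\<close> be the Fitting radical of a finitely generated U-algebra \<open>A\<close>, and let \<open>\<pi> a\<close> be
  the linear form whose coefficients are the coordinates of \<open>a\<close> modulo \<open>F\<close>. A derivation \<open>D\<close> of \<open>A\<close>
  into a finitely generated submodule \<open>N\<close> of \<open>F\<close> that is injective on \<open>F\<close> yields the embedding
  \<open>a \<mapsto> (\<pi> a, \<psi> (D a))\<close>, where \<open>\<psi>\<close> embeds the torsion-free module \<open>N\<close> into a free one. If \<open>A \<noteq> F\<close>,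
  the inner derivation \<open>a \<mapsto> a \<circ> b\<close> of a basis element \<open>b\<close> will do: it agrees with multiplication by
  \<open>x\<^sub>b\<close> on \<open>F\<close>, and the products of elements of \<open>A\<close> form a finitely generated module. If \<open>A = F\<close>, the
  identity is such a derivation.
\<close>

section \<open>Polynomials in a set of variables\<close>

lemma lookup_map:
  "f 0 = 0 \<Longrightarrow> Poly_Mapping.lookup (Poly_Mapping.map f p) k = f (Poly_Mapping.lookup p k)"
  by (simp add: Poly_Mapping.map.rep_eq when_def)

lemma poly_mapping_eq_sum_single:
  "p = (\<Sum>m\<in>Poly_Mapping.keys p. Poly_Mapping.single m (Poly_Mapping.lookup p m))"
  for p :: "'a \<Rightarrow>\<^sub>0 'b::comm_monoid_add"
proof (rule poly_mapping_eqI)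
  fix k
  show "Poly_Mapping.lookup p k = Poly_Mapping.lookup
    (\<Sum>m\<in>Poly_Mapping.keys p. Poly_Mapping.single m (Poly_Mapping.lookup p m)) k"
    by (cases "k \<in> Poly_Mapping.keys p")
      (simp_all add: lookup_sum lookup_single when_def in_keys_iff)
qed

lemma poly_mapping_induct_single_add [case_names zero single add]:
  fixes p :: "'a \<Rightarrow>\<^sub>0 'b::comm_monoid_add"
  assumes "P 0"
    and "\<And>m. m \<in> Poly_Mapping.keys p \<Longrightarrow> P (Poly_Mapping.single m (Poly_Mapping.lookup p m))"
    and "\<And>q r. P q \<Longrightarrow> P r \<Longrightarrow> P (q + r)"
  shows "P p"
proof -
  have "P (\<Sum>m\<in>M. Poly_Mapping.single m (Poly_Mapping.lookup p m))"
    if "M \<subseteq> Poly_Mapping.keys p" for M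
    using finite_subset [OF that finite_keys] that
    by (induction M rule: finite_induct) (auto intro: assms)
  then show ?thesis
    by (metis poly_mapping_eq_sum_single order_refl)
qed

lemma pconst_0 [simp]: "pconst 0 = 0"
  by (simp add: pconst_def)

lemma pconst_1 [simp]: "pconst 1 = 1"
  by (simp add: pconst_def)

lemma pconst_add: "pconst (a + b) = pconst a + pconst b"
  by (simp add: pconst_def single_add)

lemma pconst_mult: "pconst (a * b) = pconst a * (pconst b :: ('v, 'k::comm_semiring_1) mpoly)"
  by (simp add: pconst_def mult_single)

lemma lookup_pconst_mult:
  "Poly_Mapping.lookup (pconst c * p) m = c * Poly_Mapping.lookup p m"
  for p :: "('v, 'k::comm_semiring_1) mpoly"
  unfolding pconst_def mult_map_scale_conv_mult [symmetric] by (simp add: lookup_map)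

lemma single_eq_pconst_mult:
  "Poly_Mapping.single m c
    = pconst c * (Poly_Mapping.single m 1 :: ('v, 'k::comm_semiring_1) mpoly)"
  by (simp add: pconst_def mult_single)

lemma inj_pvar: "inj (pvar :: 'v \<Rightarrow> ('v, 'k::zero_neq_one) mpoly)"
  by (rule injI) (metis pvar_def keys_single singleton_inject zero_neq_one)

lemma polys_in_0 [simp]: "0 \<in> polys_in V"
  by (simp add: polys_in_def)

lemma polys_in_1 [simp]: "(1 :: ('v, 'k::comm_semiring_1) mpoly) \<in> polys_in V"
  by (simp add: polys_in_def)

lemma polys_in_pconst [simp]: "pconst c \<in> polys_in V"
  by (simp add: polys_in_def pconst_def)

lemma polys_in_pvar [simp]: "v \<in> V \<Longrightarrow> (pvar v :: ('v, 'k::comm_semiring_1) mpoly) \<in> polys_in V"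
  by (simp add: polys_in_def pvar_def)

lemma polys_in_add [simp]:
  "p \<in> polys_in V \<Longrightarrow> q \<in> polys_in V \<Longrightarrow> p + q \<in> polys_in V"
  for p q :: "('v, 'k::comm_semiring_1) mpoly"
  using keys_add [of p q] by (fastforce simp: polys_in_def)

lemma polys_in_mult [simp]:
  fixes p q :: "('v, 'k::comm_semiring_1) mpoly"
  assumes "p \<in> polys_in V" "q \<in> polys_in V"
  shows "p * q \<in> polys_in V"
proof -
  have "Poly_Mapping.keys m \<subseteq> V" if m: "m \<in> Poly_Mapping.keys (p * q)" for m
  proof -
    obtain a b where "m = a + b" "a \<in> Poly_Mapping.keys p" "b \<in> Poly_Mapping.keys q"
      using keys_mult [of p q] m by blast
    then show ?thesis
      using assms keys_add [of a b] by (fastforce simp: polys_in_def)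
  qed
  then show ?thesis
    by (simp add: polys_in_def)
qed

lemma polys_in_diff [simp]:
  "p \<in> polys_in V \<Longrightarrow> q \<in> polys_in V \<Longrightarrow> p - q \<in> polys_in V"
  for p q :: "('v, 'k::comm_ring_1) mpoly"
  using keys_diff [of p q] by (fastforce simp: polys_in_def)

lemma polys_in_empty: "p \<in> polys_in {} \<Longrightarrow> p = pconst (Poly_Mapping.lookup p 0)"
  for p :: "('v, 'k::zero) mpoly"
  by (rule poly_mapping_eqI)
    (auto simp: polys_in_def pconst_def lookup_single when_def in_keys_iff)

lemma mult_monomial_closed:
  fixes Q :: "('v, 'k::comm_semiring_1) mpoly \<Rightarrow> bool"
  assumes "Poly_Mapping.keys m \<subseteq> V" and mult_var: "\<And>p v. Q p \<Longrightarrow> v \<in> V \<Longrightarrow> Q (p * pvar v)"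
  shows "Q p \<Longrightarrow> Q (p * Poly_Mapping.single m 1)"
proof (induction m arbitrary: p rule: poly_mapping_induct_single_add)
  case (single v)
  have "Q (p * Poly_Mapping.single (Poly_Mapping.single v n) 1)" for n
  proof (induction n)
    case (Suc n)
    have "Poly_Mapping.single (Poly_Mapping.single v (Suc n)) 1
        = Poly_Mapping.single (Poly_Mapping.single v n) 1 * (pvar v :: ('v, 'k) mpoly)"
      by (simp add: pvar_def mult_single flip: single_add)
    with Suc mult_var assms(1) single(1) show ?case
      by (auto simp flip: mult.assoc)
  qed (use single(2) in simp)
  then show ?case .
next
  case (add m n)
  have "Poly_Mapping.single (m + n) 1
      = Poly_Mapping.single m 1 * (Poly_Mapping.single n 1 :: ('v, 'k) mpoly)"
    by (simp add: mult_single)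
  with add show ?case
    by (simp flip: mult.assoc)
qed simp

lemma polys_in_induct [consumes 1, case_names const add mult_var]:
  fixes P :: "('v, 'k::comm_semiring_1) mpoly \<Rightarrow> bool"
  assumes p: "p \<in> polys_in V" and const: "\<And>c. P (pconst c)"
    and add: "\<And>p q. p \<in> polys_in V \<Longrightarrow> q \<in> polys_in V \<Longrightarrow> P p \<Longrightarrow> P q \<Longrightarrow> P (p + q)"
    and mult_var: "\<And>p v. p \<in> polys_in V \<Longrightarrow> P p \<Longrightarrow> v \<in> V \<Longrightarrow> P (p * pvar v)"
  shows "P p"
proof -
  have "p \<in> polys_in V \<and> P p"
  proof (induction p rule: poly_mapping_induct_single_add)
    case zero
    show ?case
      using const [of 0] by simp
  next
    case (single m)
    then have "Poly_Mapping.keys m \<subseteq> V"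
      using p by (simp add: polys_in_def)
    then show ?case
      by (subst (1 2) single_eq_pconst_mult)
        (rule mult_monomial_closed [where V = V], simp_all add: const mult_var)
  qed (simp add: add)
  then show ?thesis ..
qed

section \<open>Substitution\<close>

definition monom_subst :: "('v \<Rightarrow> 'b::comm_semiring_1) \<Rightarrow> ('v \<Rightarrow>\<^sub>0 nat) \<Rightarrow> 'b" where
  "monom_subst \<sigma> m = (\<Prod>v\<in>Poly_Mapping.keys m. \<sigma> v ^ Poly_Mapping.lookup m v)"

lemma monom_subst_superset:
  assumes "finite V" "Poly_Mapping.keys m \<subseteq> V"
  shows "monom_subst \<sigma> m = (\<Prod>v\<in>V. \<sigma> v ^ Poly_Mapping.lookup m v)"
  unfolding monom_subst_def
  by (rule prod.mono_neutral_left) (use assms in \<open>auto simp: in_keys_iff\<close>)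

lemma monom_subst_add: "monom_subst \<sigma> (m + n) = monom_subst \<sigma> m * monom_subst \<sigma> n"
proof -
  have "monom_subst \<sigma> k
      = (\<Prod>v\<in>Poly_Mapping.keys m \<union> Poly_Mapping.keys n. \<sigma> v ^ Poly_Mapping.lookup k v)"
    if "k \<in> {m, n, m + n}" for k
    by (rule monom_subst_superset) (use that keys_add [of m n] in auto)
  then show ?thesis
    by (simp add: lookup_add power_add prod.distrib)
qed

definition poly_subst ::
    "('v \<Rightarrow> ('w, 'k) mpoly) \<Rightarrow> ('v, 'k::comm_semiring_1) mpoly \<Rightarrow> ('w, 'k) mpoly" where
  "poly_subst \<sigma> p = (\<Sum>m\<in>Poly_Mapping.keys p. pconst (Poly_Mapping.lookup p m) * monom_subst \<sigma> m)"

lemma poly_subst_superset: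
  assumes "finite M" "Poly_Mapping.keys p \<subseteq> M"
  shows "poly_subst \<sigma> p = (\<Sum>m\<in>M. pconst (Poly_Mapping.lookup p m) * monom_subst \<sigma> m)"
  unfolding poly_subst_def
  by (rule sum.mono_neutral_left) (use assms in \<open>auto simp: in_keys_iff\<close>)

lemma poly_subst_add: "poly_subst \<sigma> (p + q) = poly_subst \<sigma> p + poly_subst \<sigma> q"
proof -
  have "poly_subst \<sigma> r = (\<Sum>m\<in>Poly_Mapping.keys p \<union> Poly_Mapping.keys q.
      pconst (Poly_Mapping.lookup r m) * monom_subst \<sigma> m)" if "r \<in> {p, q, p + q}" for r
    by (rule poly_subst_superset) (use that keys_add [of p q] in auto)
  then show ?thesis
    by (simp add: lookup_add pconst_add distrib_right sum.distrib)
qed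

lemma poly_subst_0 [simp]: "poly_subst \<sigma> 0 = 0"
  by (simp add: poly_subst_def)

lemma poly_subst_single: "poly_subst \<sigma> (Poly_Mapping.single m c) = pconst c * monom_subst \<sigma> m"
  by (cases "c = 0") (simp_all add: poly_subst_def)

lemma poly_subst_pconst [simp]: "poly_subst \<sigma> (pconst c) = pconst c"
  by (simp add: pconst_def poly_subst_single monom_subst_def)

lemma poly_subst_1 [simp]: "poly_subst \<sigma> 1 = 1"
  using poly_subst_pconst [of \<sigma> 1] by simp

lemma poly_subst_pvar [simp]: "poly_subst \<sigma> (pvar v) = \<sigma> v"
  by (simp add: pvar_def poly_subst_single monom_subst_def)

lemma poly_subst_mult: "poly_subst \<sigma> (p * q) = poly_subst \<sigma> p * poly_subst \<sigma> q"
proof (induction p rule: poly_mapping_induct_single_add)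
  case (single m)
  show ?case
  proof (induction q rule: poly_mapping_induct_single_add)
    case (single n)
    show ?case
      by (simp add: mult_single poly_subst_single monom_subst_add pconst_mult mult_ac)
  qed (simp_all add: distrib_left poly_subst_add)
qed (simp_all add: distrib_right poly_subst_add)

lemma poly_subst_diff: "poly_subst \<sigma> (p - q) = poly_subst \<sigma> p - poly_subst \<sigma> q"
  for p q :: "('v, 'k::comm_ring_1) mpoly"
  using poly_subst_add [of \<sigma> "p - q" q] by simp

lemma poly_subst_in_polys_in:
  assumes "p \<in> polys_in V" "\<And>v. v \<in> V \<Longrightarrow> \<sigma> v \<in> polys_in W"
  shows "poly_subst \<sigma> p \<in> polys_in W"
  using assms(1) by (induction rule: polys_in_induct)
    (simp_all add: poly_subst_add poly_subst_mult assms(2))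

lemma inj_on_poly_subst:
  assumes "\<And>v. v \<in> V \<Longrightarrow> poly_subst \<tau> (\<sigma> v) = pvar v"
  shows "inj_on (poly_subst \<sigma>) (polys_in V :: ('v, 'k::comm_semiring_1) mpoly set)"
proof (rule inj_on_inverseI)
  fix p :: "('v, 'k) mpoly" assume "p \<in> polys_in V"
  then show "poly_subst \<tau> (poly_subst \<sigma> p) = p"
    by (induction rule: polys_in_induct) (simp_all add: poly_subst_add poly_subst_mult assms)
qed

lemma inj_on_poly_subst_rename:
  assumes "inj_on h V"
  shows "inj_on (poly_subst (\<lambda>v. pvar (h v))) (polys_in V)"
  by (rule inj_on_poly_subst [where \<tau> = "\<lambda>w. pvar (inv_into V h w)"]) (simp add: assms)

text \<open>The library provides this only for linearly ordered monomials; only finitely many variables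
  occur in \<open>p\<close> and \<open>q\<close>, so they can be renamed to natural numbers.\<close>

lemma mpoly_mult_eq_0_iff: "p * q = 0 \<longleftrightarrow> p = 0 \<or> q = 0" for p q :: "('v, 'k::idom) mpoly"
proof
  assume "p * q = 0"
  define V where "V = (\<Union>m\<in>Poly_Mapping.keys p \<union> Poly_Mapping.keys q. Poly_Mapping.keys m)"
  have pq: "p \<in> polys_in V" "q \<in> polys_in V"
    by (auto simp: V_def polys_in_def)
  have "finite V"
    by (simp add: V_def)
  then obtain h :: "'v \<Rightarrow> nat" where h: "inj_on h V"
    using finite_imp_inj_to_nat_seg by blast
  let ?ren = "poly_subst (\<lambda>v. pvar (h v)) :: ('v, 'k) mpoly \<Rightarrow> (nat, 'k) mpoly"
  have "?ren p * ?ren q = 0"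
    using \<open>p * q = 0\<close> by (metis poly_subst_mult poly_subst_0)
  then have "?ren p = ?ren 0 \<or> ?ren q = ?ren 0"
    by simp
  then show "p = 0 \<or> q = 0"
    using inj_on_poly_subst_rename [OF h] pq by (metis inj_on_eq_iff polys_in_0)
qed auto

lemma mpoly_power_eq_0: "p ^ n = 0 \<Longrightarrow> p = 0" for p :: "('v, 'k::idom) mpoly"
  by (induction n) (auto simp: mpoly_mult_eq_0_iff)

section \<open>Linear forms\<close>

abbreviation poly_scale :: "'k::field \<Rightarrow> ('v, 'k) mpoly \<Rightarrow> ('v, 'k) mpoly" where
  "poly_scale c p \<equiv> pconst c * p"

interpretation mpoly: vector_space poly_scale
  by unfold_locales (simp_all add: distrib_left pconst_add distrib_right pconst_mult mult.assoc)

lemma linear_poly_subst: "Vector_Spaces.linear poly_scale poly_scale (poly_subst \<sigma>)"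
  by (simp add: Vector_Spaces.linear_iff mpoly.vector_space_axioms poly_subst_add poly_subst_mult)

definition linear_forms :: "'v set \<Rightarrow> ('v, 'k::field) mpoly set" where
  "linear_forms V = {p. \<forall>m\<in>Poly_Mapping.keys p. \<exists>v\<in>V. m = Poly_Mapping.single v 1}"

lemma linear_forms_eq_span: "(linear_forms V :: ('v, 'k::field) mpoly set) = mpoly.span (pvar ` V)"
proof
  show "(linear_forms V :: ('v, 'k) mpoly set) \<subseteq> mpoly.span (pvar ` V)"
  proof
    fix p :: "('v, 'k) mpoly" assume p: "p \<in> linear_forms V"
    show "p \<in> mpoly.span (pvar ` V)"
    proof (induction p rule: poly_mapping_induct_single_add)
      case zero
      show ?case
        by (rule mpoly.span_zero)
    next
      case (single m)
      then have "Poly_Mapping.single m 1 \<in> (pvar ` V :: ('v, 'k) mpoly set)"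
        using p by (auto simp: linear_forms_def pvar_def)
      then show ?case
        by (subst single_eq_pconst_mult) (intro mpoly.span_scale mpoly.span_base)
    next
      case (add q r)
      then show ?case
        by (rule mpoly.span_add)
    qed
  qed
  have "mpoly.subspace (linear_forms V :: ('v, 'k) mpoly set)"
  proof (rule mpoly.subspaceI)
    show "p + q \<in> linear_forms V" if "p \<in> linear_forms V" "q \<in> linear_forms V"
      for p q :: "('v, 'k) mpoly"
      using that keys_add [of p q] unfolding linear_forms_def by blast
    show "pconst c * p \<in> linear_forms V" if "p \<in> linear_forms V" for c and p :: "('v, 'k) mpoly"
      using that by (auto simp: linear_forms_def in_keys_iff lookup_pconst_mult)
  qed (simp add: linear_forms_def)
  then show "mpoly.span (pvar ` V) \<subseteq> (linear_forms V :: ('v, 'k) mpoly set)"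
    by (intro mpoly.span_minimal) (auto simp: linear_forms_def pvar_def)
qed

lemma linear_forms_subset_polys_in: "linear_forms V \<subseteq> polys_in V"
  by (fastforce simp: linear_forms_def polys_in_def)

lemma poly_subst_rename_linear_forms:
  assumes "p \<in> linear_forms V"
  shows "poly_subst (\<lambda>v. pvar (h v)) p \<in> linear_forms (h ` V)"
proof -
  interpret poly_subst: Vector_Spaces.linear poly_scale poly_scale "poly_subst (\<lambda>v. pvar (h v))"
    by (rule linear_poly_subst)
  show ?thesis
    using imageI [OF assms, of "poly_subst (\<lambda>v. pvar (h v))"]
    unfolding linear_forms_eq_span poly_subst.span_image [symmetric] by (simp add: image_image)
qed

lemma lookup_pvar: "Poly_Mapping.lookup (pvar v) (Poly_Mapping.single w 1) = (1 when v = w)"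
proof -
  have "Poly_Mapping.single v (1 :: nat) = Poly_Mapping.single w 1 \<longleftrightarrow> v = w"
    by (metis keys_single singleton_inject zero_neq_one)
  then show ?thesis
    by (simp add: pvar_def lookup_single)
qed

lemma independent_pvar: "mpoly.independent (pvar ` V :: ('v, 'k::field) mpoly set)"
  unfolding mpoly.dependent_explicit
proof clarify
  fix t :: "('v, 'k) mpoly set" and u q
  assume t: "finite t" "t \<subseteq> pvar ` V" "(\<Sum>p\<in>t. pconst (u p) * p) = 0" "q \<in> t" "u q \<noteq> 0"
  then obtain w where w: "q = pvar w"
    by blast
  have "0 = (\<Sum>p\<in>t. u p * Poly_Mapping.lookup p (Poly_Mapping.single w 1))"
    using arg_cong [OF t(3), of "\<lambda>p. Poly_Mapping.lookup p (Poly_Mapping.single w 1)"]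
    by (simp add: lookup_sum lookup_pconst_mult)
  also have "\<dots> = (\<Sum>p\<in>t. if p = q then u p else 0)"
    by (intro sum.cong) (auto simp: w lookup_pvar when_def simp del: One_nat_def
        dest!: subsetD [OF t(2)] split: if_splits)
  finally show False
    using t(1,4,5) by simp
qed

text \<open>Linearly independent linear forms are algebraically independent: a linear map that sends them
  to variables induces a substitution, which inverts the given one.\<close>

lemma inj_on_poly_subst_independent:
  fixes \<sigma> :: "'v \<Rightarrow> ('w, 'k::field) mpoly"
  assumes forms: "\<sigma> ` V \<subseteq> linear_forms W"
    and indep: "mpoly.independent (\<sigma> ` V)" and inj: "inj_on \<sigma> V"
  shows "inj_on (poly_subst \<sigma>) (polys_in V)"
proof -
  interpret vector_space_pair "poly_scale :: 'k \<Rightarrow> ('w, 'k) mpoly \<Rightarrow> _"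
      "poly_scale :: 'k \<Rightarrow> ('v, 'k) mpoly \<Rightarrow> _"
    by unfold_locales
  obtain g where linear_g: "Vector_Spaces.linear poly_scale poly_scale g"
    and g: "\<forall>p\<in>\<sigma> ` V. g p = pvar (inv_into V \<sigma> p)"
    using linear_independent_extend [OF indep, of "\<lambda>p. pvar (inv_into V \<sigma> p)"] by blast
  define \<tau> where "\<tau> w = g (pvar w)" for w
  have subst_eq: "poly_subst \<tau> p = g p" if "p \<in> linear_forms W" for p
  proof (rule linear_eq_on [OF linear_poly_subst linear_g])
    show "p \<in> mpoly.span (pvar ` W)"
      using that by (simp add: linear_forms_eq_span)
  qed (auto simp: \<tau>_def)
  show ?thesis
  proof (rule inj_on_poly_subst [where \<tau> = \<tau>])
    show "poly_subst \<tau> (\<sigma> v) = pvar v" if "v \<in> V" for v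
      using that subst_eq forms g inj by auto
  qed
qed

section \<open>Bases modulo a subspace\<close>

context vector_space
begin

lemma span_Int_of_independent_Un:
  assumes "S \<inter> T = {}" and ST: "independent (S \<union> T)"
  shows "span S \<inter> span T = {0}"
proof -
  have "x = 0" if x: "x \<in> span S" "x \<in> span T" for x
  proof -
    have eq: "representation S x = representation T x"
      using representation_extend [OF ST x(1)] representation_extend [OF ST x(2)] by simp
    have "representation S x b = 0" for b
    proof (rule ccontr)
      assume "representation S x b \<noteq> 0"
      then have "b \<in> S" "b \<in> T"
        using eq representation_ne_zero by metis+
      then show False
        using assms(1) by blast
    qed
    moreover have "independent S"
      by (rule independent_mono [OF ST]) simp
    ultimately show "x = 0"
      using sum_nonzero_representation_eq [OF _ x(1)] by simp
  qed
  then show ?thesis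
    using span_zero by blast
qed

lemma independent_Un:
  assumes S: "independent S" and T: "independent T" and Int: "span S \<inter> span T = {0}"
  shows "independent (S \<union> T)"
  unfolding independent_explicit_module
proof (intro allI impI)
  fix U u v
  assume U: "finite U" "U \<subseteq> S \<union> T" "(\<Sum>x\<in>U. scale (u x) x) = 0" and "v \<in> U"
  define s t where "s = (\<Sum>x\<in>U \<inter> S. scale (u x) x)" and "t = (\<Sum>x\<in>U - S. scale (u x) x)"
  have "s + t = (\<Sum>x\<in>U. scale (u x) x)"
    unfolding s_def t_def by (rule sum.Int_Diff [OF U(1), symmetric])
  then have s: "s = - t"
    using U(3) by (simp add: eq_neg_iff_add_eq_0)
  have "s \<in> span S" and t: "t \<in> span T"
    using U(2) by (auto simp: s_def t_def intro!: span_sum span_scale intro: span_base)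
  then have "s \<in> span S \<inter> span T"
    using span_neg [OF t] by (simp add: s)
  then have "s = 0" "t = 0"
    using Int s by auto
  moreover have "finite (U \<inter> S)" "finite (U - S)" "U - S \<subseteq> T"
    using U(1,2) by auto
  ultimately have "v \<in> U \<inter> S \<or> v \<in> U - S \<Longrightarrow> u v = 0"
    using independentD [OF S, of "U \<inter> S" u v] independentD [OF T, of "U - S" u v]
    unfolding s_def t_def by blast
  then show "u v = 0"
    using \<open>v \<in> U\<close> by blast
qed

lemma quotient_basisD:
  assumes "quotient_basis scale A J B" "finite t" "t \<subseteq> B" "(\<Sum>b\<in>t. scale (u b) b) \<in> J" "b \<in> t"
  shows "u b = 0"
  using assms unfolding quotient_basis_def by blast

lemma independent_quotient_basis:
  assumes "quotient_basis scale A J B" "subspace J"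
  shows "independent B"
  unfolding independent_explicit_module
proof (intro allI impI)
  fix t u b assume "finite t" "t \<subseteq> B" "(\<Sum>b\<in>t. scale (u b) b) = 0" "b \<in> t"
  then show "u b = 0"
    using quotient_basisD [OF assms(1)] subspace_0 [OF assms(2)] by simp
qed

lemma span_quotient_basis_Int:
  assumes "quotient_basis scale A J B" "subspace J"
  shows "span B \<inter> J = {0}"
proof -
  have "x = 0" if x: "x \<in> span B" "x \<in> J" for x
  proof -
    obtain t u where t: "x = (\<Sum>b\<in>t. scale (u b) b)" "finite t" "t \<subseteq> B"
      using x(1) by (auto simp: span_explicit)
    then have "\<forall>b\<in>t. u b = 0"
      using quotient_basisD [OF assms(1)] x(2) by blast
    then show "x = 0"
      by (simp add: t(1))
  qed
  then show ?thesis
    using span_zero subspace_0 [OF assms(2)] by blast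
qed

lemma quotient_basis_iff:
  assumes "subspace J"
  shows "quotient_basis scale A J B
    \<longleftrightarrow> B \<subseteq> A \<and> A \<subseteq> span (B \<union> J) \<and> independent B \<and> span B \<inter> J = {0}" (is "_ \<longleftrightarrow> ?complement")
proof
  assume B: "quotient_basis scale A J B"
  then show ?complement
    using independent_quotient_basis [OF B assms] span_quotient_basis_Int [OF B assms]
    by (simp add: quotient_basis_def)
next
  assume B: ?complement
  have "u b = 0" if t: "finite t" "t \<subseteq> B" "(\<Sum>b\<in>t. scale (u b) b) \<in> J" "b \<in> t" for t u b
  proof -
    have "(\<Sum>b\<in>t. scale (u b) b) \<in> span B"
      using t(2) by (auto intro!: span_sum span_scale intro: span_base)
    with B t show ?thesis
      using independentD [of B t u b] by blast
  qed
  with B show "quotient_basis scale A J B"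
    by (simp add: quotient_basis_def)
qed

lemma quotient_basis_self:
  assumes "quotient_basis scale A A B" "subspace A"
  shows "B = {}"
proof -
  have B: "B \<subseteq> A \<and> A \<subseteq> span (B \<union> A) \<and> independent B \<and> span B \<inter> A = {0}"
    using assms(1) unfolding quotient_basis_iff [OF assms(2)] .
  have "b = 0" if "b \<in> B" for b
    using that B span_base [OF that] by blast
  moreover have "0 \<notin> B"
    using B dependent_zero by metis
  ultimately show ?thesis
    by blast
qed

lemma exists_quotient_basis:
  assumes "subspace J" "subspace A" "J \<subseteq> A"
  shows "\<exists>B. quotient_basis scale A J B"
proof -
  obtain C where C: "C \<subseteq> J" "independent C" "span C = J"
    using maximal_independent_subset [of J] assms(1) span_subspace by metis
  then obtain D where D: "C \<subseteq> D" "D \<subseteq> A" "independent D" "A \<subseteq> span D"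
    using maximal_independent_subset_extend [of C A] assms(3) by blast
  then have "independent ((D - C) \<union> C)"
    by (simp add: Un_absorb2)
  then have "span (D - C) \<inter> J = {0}"
    unfolding C(3) [symmetric] by (intro span_Int_of_independent_Un) auto
  moreover have "independent (D - C)"
    by (rule independent_mono [OF D(3)]) blast
  moreover have "span D \<subseteq> span ((D - C) \<union> J)"
    by (rule span_mono) (use C in auto)
  ultimately have "quotient_basis scale A J (D - C)"
    unfolding quotient_basis_iff [OF assms(1)] using D by blast
  then show ?thesis ..
qed

end

context vector_space_pair
begin

lemma exists_linear_vanishing_extend:
  assumes "quotient_basis s1 A J B" "vs1.subspace J"
  shows "\<exists>L. Vector_Spaces.linear s1 s2 L \<and> (\<forall>b\<in>B. L b = f b) \<and> (\<forall>v\<in>J. L v = 0)"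
proof -
  have B: "vs1.independent B" "vs1.span B \<inter> J = {0}"
    using assms by (simp_all add: vs1.quotient_basis_iff)
  obtain C where C: "C \<subseteq> J" "vs1.independent C" "vs1.span C = J"
    using vs1.maximal_independent_subset [of J] assms(2) vs1.span_subspace by metis
  have disjoint: "B \<inter> C = {}"
  proof -
    have "x = 0" if "x \<in> B" "x \<in> C" for x
      using that B(2) C(1) vs1.span_base [OF that(1)] by blast
    moreover have "0 \<notin> B"
      using B(1) vs1.dependent_zero by metis
    ultimately show ?thesis
      by blast
  qed
  then have "vs1.independent (B \<union> C)"
    using B C by (intro vs1.independent_Un) simp_all
  then obtain L where L: "Vector_Spaces.linear s1 s2 L"
      "\<forall>x\<in>B \<union> C. L x = (if x \<in> B then f x else 0)"
    using linear_independent_extend [of "B \<union> C" "\<lambda>x. if x \<in> B then f x else 0"] by blast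
  have "L v = 0" if "v \<in> J" for v
  proof (rule linear_eq_0_on_span [OF L(1)])
    show "v \<in> vs1.span C"
      using C(3) that by simp
  qed (use L(2) disjoint in auto)
  with L show ?thesis
    by auto
qed

lemma
  assumes "quotient_basis s1 A J B" "vs1.subspace J" "vs1.subspace A"
    and f: "Vector_Spaces.linear s1 s2 f" "\<And>x. x \<in> A \<Longrightarrow> f x = 0 \<Longrightarrow> x \<in> J"
  shows inj_on_quotient_basis: "inj_on f B"
    and independent_image_quotient_basis: "vs2.independent (f ` B)"
proof -
  have B: "B \<subseteq> A" "vs1.independent B" "vs1.span B \<inter> J = {0}"
    using assms(1,2) by (simp_all add: vs1.quotient_basis_iff)
  have "vs1.span B \<subseteq> A"
    using B(1) assms(3) by (rule vs1.span_minimal)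
  then have inj: "inj_on f (vs1.span B)"
    using B(3) f(2) by (auto simp: linear_inj_on_iff_eq_0 [OF f(1)])
  then show "inj_on f B"
    using vs1.span_superset by (rule inj_on_subset)
  show "vs2.independent (f ` B)"
    by (rule linear_independent_injective_image [OF f(1) B(2) inj])
qed

end

lemma (in vector_space) finite_quotient_basis:
  assumes B: "quotient_basis scale A J B" and J: "subspace J"
    and X: "finite X" "A \<subseteq> span (X \<union> J)"
  shows "finite B"
proof -
  interpret vector_space_pair scale scale
    by unfold_locales
  obtain L where linear_L: "Vector_Spaces.linear scale scale L"
    and L: "\<forall>b\<in>B. L b = b" "\<forall>v\<in>J. L v = 0"
    using exists_linear_vanishing_extend [OF B J, of "\<lambda>b. b"] by blast
  have "B \<subseteq> A" and "independent B"
    using B by (simp_all add: quotient_basis_iff [OF J])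
  have "B = L ` B"
    using L(1) by force
  also have "\<dots> \<subseteq> span (L ` (X \<union> J))"
    using linear_spans_image [OF linear_L] \<open>B \<subseteq> A\<close> X(2) by (meson order_trans)
  also have "\<dots> \<subseteq> span (insert 0 (L ` X))"
    by (rule span_mono) (use L(2) in auto)
  finally have "B \<subseteq> span (L ` X)"
    by simp
  then show ?thesis
    using independent_span_bound [OF _ \<open>independent B\<close>] X(1) by blast
qed

section \<open>Lie algebras and the Fitting radical\<close>

locale lie_algebra_on =
  fixes sc :: "'k::field \<Rightarrow> 'a::ab_group_add \<Rightarrow> 'a" and br :: "'a \<Rightarrow> 'a \<Rightarrow> 'a" and A :: "'a set"
  assumes lie_algebra: "lie_algebra sc br A"
begin

sublocale vector_space sc
  using lie_algebra by (simp add: lie_algebra_def)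

lemma carrier_subspace: "subspace A"
  using lie_algebra by (simp add: lie_algebra_def)

lemmas carrier_0 = subspace_0 [OF carrier_subspace]
  and carrier_add = subspace_add [OF carrier_subspace]
  and carrier_scale = subspace_scale [OF carrier_subspace]
  and carrier_diff = subspace_diff [OF carrier_subspace]

lemma br_closed: "x \<in> A \<Longrightarrow> y \<in> A \<Longrightarrow> br x y \<in> A"
  and br_add_left: "x \<in> A \<Longrightarrow> y \<in> A \<Longrightarrow> z \<in> A \<Longrightarrow> br (x + y) z = br x z + br y z"
  and br_add_right: "x \<in> A \<Longrightarrow> y \<in> A \<Longrightarrow> z \<in> A \<Longrightarrow> br z (x + y) = br z x + br z y"
  and br_scale_left: "x \<in> A \<Longrightarrow> y \<in> A \<Longrightarrow> br (sc c x) y = sc c (br x y)"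
  and br_scale_right: "x \<in> A \<Longrightarrow> y \<in> A \<Longrightarrow> br x (sc c y) = sc c (br x y)"
  and br_self: "x \<in> A \<Longrightarrow> br x x = 0"
  and jacobi: "x \<in> A \<Longrightarrow> y \<in> A \<Longrightarrow> z \<in> A \<Longrightarrow> br x (br y z) + br y (br z x) + br z (br x y) = 0"
  using lie_algebra unfolding lie_algebra_def by simp_all

lemma br_anti: "x \<in> A \<Longrightarrow> y \<in> A \<Longrightarrow> br x y = - br y x"
  using br_self [of "x + y"] br_self [of x] br_self [of y]
  by (simp add: br_add_left br_add_right carrier_add eq_neg_iff_add_eq_0 add.commute)

lemma br_0_left: "y \<in> A \<Longrightarrow> br 0 y = 0"
  using br_scale_left [of 0 y 0] carrier_0 by simp

lemma br_0_right: "x \<in> A \<Longrightarrow> br x 0 = 0"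
  using br_scale_right [of x 0 0] carrier_0 by simp

lemma br_minus_left: "x \<in> A \<Longrightarrow> y \<in> A \<Longrightarrow> br (- x) y = - br x y"
  using br_scale_left [of x y "- 1"] by simp

lemma subspace_br_left_vimage:
  "subspace U \<Longrightarrow> y \<in> A \<Longrightarrow> subspace {x \<in> A. br x y \<in> U}"
  by (rule subspaceI)
    (auto simp: br_0_left br_add_left br_scale_left carrier_0 carrier_add carrier_scale
      subspace_0 subspace_add subspace_scale)

lemma subspace_br_right_vimage:
  "subspace U \<Longrightarrow> x \<in> A \<Longrightarrow> subspace {y \<in> A. br x y \<in> U}"
  by (rule subspaceI)
    (auto simp: br_0_right br_add_right br_scale_right carrier_0 carrier_add carrier_scale
      subspace_0 subspace_add subspace_scale)

lemma br_span_in_subspace: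
  assumes XY: "X \<subseteq> A" "Y \<subseteq> A" and U: "subspace U" "\<And>x y. x \<in> X \<Longrightarrow> y \<in> Y \<Longrightarrow> br x y \<in> U"
    and "a \<in> span X" "b \<in> span Y"
  shows "br a b \<in> U"
proof -
  have "b \<in> A"
    using span_minimal [OF XY(2) carrier_subspace] \<open>b \<in> span Y\<close> by blast
  have "br x b \<in> U" if "x \<in> X" for x
  proof -
    have "span Y \<subseteq> {y \<in> A. br x y \<in> U}"
      by (rule span_minimal [OF _ subspace_br_right_vimage]) (use XY U that in auto)
    then show ?thesis
      using \<open>b \<in> span Y\<close> by blast
  qed
  then have "span X \<subseteq> {x \<in> A. br x b \<in> U}"
    by (intro span_minimal subspace_br_left_vimage U(1) \<open>b \<in> A\<close>) (use XY(1) in auto)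
  then show ?thesis
    using \<open>a \<in> span X\<close> by blast
qed

lemma lie_ideal_carrier: "lie_ideal sc br A A"
  by (simp add: lie_ideal_def carrier_subspace br_closed)

lemma lie_ideal_br_left:
  assumes "lie_ideal sc br A J" "a \<in> A" "x \<in> J"
  shows "br a x \<in> J"
proof -
  have "x \<in> A" "br x a \<in> J" "subspace J"
    using assms by (auto simp: lie_ideal_def)
  then show ?thesis
    using br_anti [OF assms(2)] subspace_neg by simp
qed

text \<open>Modulo \<open>J\<close> the generators commute, so they span the quotient and it is abelian.\<close>

lemma
  assumes J: "lie_ideal sc br A J" and X: "X \<subseteq> A" "lie_generated sc br A X = A"
    and XJ: "\<And>x y. x \<in> X \<Longrightarrow> y \<in> X \<Longrightarrow> br x y \<in> J"
  shows carrier_subset_span_generators: "A \<subseteq> span (X \<union> J)"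
    and br_in_ideal_of_generators: "a \<in> A \<Longrightarrow> b \<in> A \<Longrightarrow> br a b \<in> J"
proof -
  have JA: "J \<subseteq> A" and J_subspace: "subspace J" and J_br: "\<And>x a. x \<in> J \<Longrightarrow> a \<in> A \<Longrightarrow> br x a \<in> J"
    using J by (auto simp: lie_ideal_def)
  have XJA: "X \<union> J \<subseteq> A"
    using X(1) JA by simp
  have "br x y \<in> J" if xy: "x \<in> X \<union> J" "y \<in> X \<union> J" for x y
  proof -
    have "x \<in> A" "y \<in> A"
      using xy XJA by auto
    then show ?thesis
      using xy XJ J_br lie_ideal_br_left [OF J] by (elim UnE) simp_all
  qed
  then have br_J: "br x y \<in> J" if "x \<in> span (X \<union> J)" "y \<in> span (X \<union> J)" for x y
    using br_span_in_subspace [OF XJA XJA J_subspace _ that] by simp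
  have "span (X \<union> J) \<subseteq> A"
    using XJA carrier_subspace by (rule span_minimal)
  moreover have "J \<subseteq> span (X \<union> J)" "X \<subseteq> span (X \<union> J)"
    using span_superset [of "X \<union> J"] by simp_all
  ultimately have "lie_subalgebra sc br A (span (X \<union> J))"
    unfolding lie_subalgebra_def using br_J by (simp add: subset_iff)
  then show A_span: "A \<subseteq> span (X \<union> J)"
    using X(2) \<open>X \<subseteq> span (X \<union> J)\<close> unfolding lie_generated_def by blast
  show "br a b \<in> J" if "a \<in> A" "b \<in> A"
    using br_J [OF subsetD [OF A_span that(1)] subsetD [OF A_span that(2)]] .
qed

lemma nilpotent_ideal_of_abelian:
  assumes "lie_ideal sc br A J" "abelian_set br J"
  shows "nilpotent_ideal sc br A J"
proof -
  have "{br x y | x y. x \<in> J \<and> y \<in> J} \<subseteq> {0}"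
    using assms(2) by (auto simp: abelian_set_def)
  then have "lower_central sc br J 1 \<subseteq> span {0}"
    by (simp add: bracket_span_def span_mono del: span_insert_0)
  then have "lower_central sc br J 1 = {0}"
    using span_zero by (auto simp: bracket_span_def)
  then show ?thesis
    using assms(1) unfolding nilpotent_ideal_def by blast
qed

lemma funpow_br_in_lower_central:
  assumes "x \<in> J" "y \<in> J"
  shows "((\<lambda>w. br w y) ^^ n) x \<in> lower_central sc br J n"
proof (induction n)
  case (Suc n)
  then show ?case
    using assms(2) by (auto simp: bracket_span_def intro!: span_base)
qed (simp add: assms)

lemma nilpotent_ideal_subset_fitting: "nilpotent_ideal sc br A J \<Longrightarrow> J \<subseteq> fitting sc br A"
  by (auto simp: fitting_def)

lemma fitting_eqI:
  assumes "nilpotent_ideal sc br A J" "\<And>K. nilpotent_ideal sc br A K \<Longrightarrow> K \<subseteq> J"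
  shows "fitting sc br A = J"
proof
  have "lie_ideal sc br A J"
    using assms(1) by (simp add: nilpotent_ideal_def)
  then show "fitting sc br A \<subseteq> J"
    unfolding fitting_def using assms(2) by blast
qed (rule nilpotent_ideal_subset_fitting [OF assms(1)])

lemma lie_ideal_fitting: "lie_ideal sc br A (fitting sc br A)"
proof -
  have "subspace (fitting sc br A)"
    unfolding fitting_def by (rule subspace_Inter) (simp add: lie_ideal_def)
  moreover have "fitting sc br A \<subseteq> A"
    unfolding fitting_def
    by (rule Inter_lower) (use lie_ideal_carrier in \<open>auto simp: nilpotent_ideal_def lie_ideal_def\<close>)
  ultimately show ?thesis
    by (auto simp: fitting_def lie_ideal_def)
qed

lemma br_in_fitting:
  assumes "metabelian sc br A" "a \<in> A" "b \<in> A"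
  shows "br a b \<in> fitting sc br A"
proof -
  define X where "X = {br x y | x y. x \<in> A \<and> y \<in> A}"
  have XA: "X \<subseteq> A"
    by (auto simp: X_def br_closed)
  have X_span: "br x y \<in> span X" if "x \<in> A" "y \<in> A" for x y
    using that by (intro span_base) (auto simp: X_def)
  have "br u v \<in> {0}" if "u \<in> span X" "v \<in> span X" for u v
    by (rule br_span_in_subspace [OF XA XA _ _ that])
      (use assms(1) in \<open>auto simp: X_def metabelian_def\<close>)
  then have "abelian_set br (span X)"
    by (simp add: abelian_set_def)
  moreover have "span X \<subseteq> A"
    using XA carrier_subspace by (rule span_minimal)
  then have "lie_ideal sc br A (span X)"
    using X_span by (auto simp: lie_ideal_def)
  ultimately have "span X \<subseteq> fitting sc br A"
    by (intro nilpotent_ideal_subset_fitting nilpotent_ideal_of_abelian)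
  then show ?thesis
    using X_span assms(2,3) by blast
qed

end

section \<open>Polynomial actions on an ideal\<close>

lemma poly_actionD:
  assumes "poly_action sc br J B act"
  shows "v \<in> J \<Longrightarrow> f \<in> polys_in B \<Longrightarrow> act v f \<in> J"
    and "v \<in> J \<Longrightarrow> act v 1 = v"
    and "v \<in> J \<Longrightarrow> b \<in> B \<Longrightarrow> act v (pvar b) = br v b"
    and "v \<in> J \<Longrightarrow> f \<in> polys_in B \<Longrightarrow> g \<in> polys_in B \<Longrightarrow> act v (f + g) = act v f + act v g"
    and "v \<in> J \<Longrightarrow> f \<in> polys_in B \<Longrightarrow> act v (pconst c * f) = sc c (act v f)"
    and "v \<in> J \<Longrightarrow> w \<in> J \<Longrightarrow> f \<in> polys_in B \<Longrightarrow> act (v + w) f = act v f + act w f"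
    and "v \<in> J \<Longrightarrow> f \<in> polys_in B \<Longrightarrow> act (sc c v) f = sc c (act v f)"
    and "v \<in> J \<Longrightarrow> f \<in> polys_in B \<Longrightarrow> g \<in> polys_in B \<Longrightarrow> act v (f * g) = act (act v f) g"
  using assms unfolding poly_action_def by blast+

lemma poly_action_pconst:
  assumes "poly_action sc br J B act" "v \<in> J"
  shows "act v (pconst c) = sc c v"
  using poly_actionD(5) [OF assms, of 1 c] poly_actionD(2) [OF assms] by simp

lemma poly_action_unique:
  assumes act: "poly_action sc br J B act" and act': "poly_action sc br J B act'"
    and v: "v \<in> J" and f: "f \<in> polys_in B"
  shows "act v f = act' v f"
  using f
proof (induction rule: polys_in_induct)
  case (const c)
  show ?case
    by (simp add: poly_action_pconst [OF act v] poly_action_pconst [OF act' v])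
next
  case (add p q)
  then show ?case
    by (simp add: poly_actionD(4) [OF act v] poly_actionD(4) [OF act' v])
next
  case (mult_var p b)
  have "act v (p * pvar b) = br (act v p) b" if "poly_action sc br J B act" for act
    using mult_var v by (simp add: poly_actionD [OF that])
  then show ?case
    using mult_var act act' by metis
qed

lemma torsion_free_action_cong:
  assumes "poly_action sc br J B act" "poly_action sc br J B act'" "torsion_free_action J B act"
  shows "torsion_free_action J B act'"
  using assms(3) poly_action_unique [OF assms(1,2)] unfolding torsion_free_action_def by metis

context lie_algebra_on
begin

lemma U_algebraI:
  assumes "metabelian sc br A" "abelian_set br (fitting sc br A)"
    and act: "\<And>B. quotient_basis sc A (fitting sc br A) B \<Longrightarrow>
      \<exists>act. poly_action sc br (fitting sc br A) B act \<and> torsion_free_action (fitting sc br A) B act"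
  shows "U_algebra sc br A"
proof -
  have "\<exists>B. quotient_basis sc A (fitting sc br A) B"
    using lie_ideal_fitting carrier_subspace
    by (intro exists_quotient_basis) (auto simp: lie_ideal_def)
  then show ?thesis
    unfolding U_algebra_def using assms(1,2) act torsion_free_action_cong by meson
qed

lemma
  shows poly_action_empty: "poly_action sc br A {} (\<lambda>v f. sc (Poly_Mapping.lookup f 0) v)"
    and torsion_free_action_empty: "torsion_free_action A {} (\<lambda>v f. sc (Poly_Mapping.lookup f 0) v)"
proof -
  have lookup_mult: "Poly_Mapping.lookup (f * g) 0
      = Poly_Mapping.lookup f 0 * Poly_Mapping.lookup g 0"
    if "f \<in> polys_in {}" for f g :: "('a, 'k) mpoly"
    by (subst polys_in_empty [OF that]) (rule lookup_pconst_mult)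
  moreover have "Poly_Mapping.lookup (pconst c) 0 = c" for c :: 'k
    by (simp add: pconst_def)
  ultimately show "poly_action sc br A {} (\<lambda>v f. sc (Poly_Mapping.lookup f 0) v)"
    unfolding poly_action_def
    by (auto simp: lookup_pconst_mult lookup_add scale_left_distrib scale_right_distrib mult_ac
        intro: carrier_scale)
  show "torsion_free_action A {} (\<lambda>v f. sc (Poly_Mapping.lookup f 0) v)"
    unfolding torsion_free_action_def using polys_in_empty by (metis scale_eq_0_iff pconst_0)
qed

lemma U_algebra_of_abelian:
  assumes "abelian_set br A"
  shows "U_algebra sc br A"
proof -
  have fitting: "fitting sc br A = A"
    by (rule fitting_eqI [OF nilpotent_ideal_of_abelian [OF lie_ideal_carrier assms]])
      (simp add: nilpotent_ideal_def lie_ideal_def)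
  show ?thesis
  proof (rule U_algebraI)
    show "metabelian sc br A"
      using assms lie_algebra br_closed by (simp add: metabelian_def abelian_set_def)
    show "\<exists>act. poly_action sc br (fitting sc br A) B act
        \<and> torsion_free_action (fitting sc br A) B act"
      if "quotient_basis sc A (fitting sc br A) B" for B
      using quotient_basis_self [OF that [unfolded fitting] carrier_subspace]
        poly_action_empty torsion_free_action_empty by (auto simp: fitting)
  qed (simp add: fitting assms)
qed

end

section \<open>Subalgebras of the matrix algebra\<close>

lemma mat_eqI:
  "fst p = fst q \<Longrightarrow> (\<And>i. Poly_Mapping.lookup (snd p) i = Poly_Mapping.lookup (snd q) i) \<Longrightarrow> p = q"
  by (simp add: prod_eq_iff poly_mapping_eqI)

lemma fst_mat_scale [simp]: "fst (mat_scale c p) = pconst c * fst p"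
  and lookup_mat_scale [simp]:
    "Poly_Mapping.lookup (snd (mat_scale c p)) i = pconst c * Poly_Mapping.lookup (snd p) i"
  by (simp_all add: mat_scale_def lookup_map)

lemma fst_mat_br [simp]: "fst (mat_br p q) = 0"
  and lookup_mat_br [simp]: "Poly_Mapping.lookup (snd (mat_br p q)) i
    = Poly_Mapping.lookup (snd p) i * fst q - Poly_Mapping.lookup (snd q) i * fst p"
  by (simp_all add: mat_br_def lookup_minus lookup_map)

lemma matM0_iff: "p \<in> matM0 I \<Lambda> \<longleftrightarrow> fst p \<in> linear_forms \<Lambda>
    \<and> Poly_Mapping.keys (snd p) \<subseteq> I \<and> (\<forall>i. Poly_Mapping.lookup (snd p) i \<in> polys_in \<Lambda>)"
  using subsetD [OF linear_forms_subset_polys_in, of "fst p" \<Lambda>]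
  unfolding matM0_def matM_def linear_forms_def by blast

interpretation mat: vector_space "mat_scale :: 'k::field \<Rightarrow> ('i, 'l, 'k) mat_elem \<Rightarrow> _"
  by unfold_locales
    (auto intro!: mat_eqI simp: lookup_add mpoly.scale_left_distrib mpoly.scale_right_distrib)

lemma lie_algebra_mat:
  assumes "lie_subalgebra mat_scale mat_br M T"
  shows "lie_algebra mat_scale mat_br T"
  using assms unfolding lie_algebra_def lie_subalgebra_def
  by (auto intro!: mat_eqI mat.vector_space_axioms simp: lookup_add algebra_simps)

lemma metabelian_mat:
  assumes "lie_subalgebra mat_scale mat_br M T"
  shows "metabelian mat_scale mat_br T"
  using lie_algebra_mat [OF assms] unfolding metabelian_def by (auto intro!: mat_eqI)

definition strictly_upper :: "('i, 'l, 'k::field) mat_elem set \<Rightarrow> ('i, 'l, 'k) mat_elem set" where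
  "strictly_upper T = {p \<in> T. fst p = 0}"

lemma lie_ideal_strictly_upper:
  assumes "lie_subalgebra mat_scale mat_br M T"
  shows "lie_ideal mat_scale mat_br T (strictly_upper T)"
  using assms unfolding lie_ideal_def lie_subalgebra_def strictly_upper_def
  by (auto intro!: mat.subspaceI intro: mat.subspace_0 mat.subspace_add mat.subspace_scale)

lemma abelian_strictly_upper: "abelian_set mat_br (strictly_upper T)"
  by (auto simp: abelian_set_def strictly_upper_def intro!: mat_eqI)

lemma funpow_mat_br:
  assumes "fst w = 0"
  shows "fst (((\<lambda>w. mat_br w q) ^^ n) w) = 0"
    and "Poly_Mapping.lookup (snd (((\<lambda>w. mat_br w q) ^^ n) w)) i
      = Poly_Mapping.lookup (snd w) i * fst q ^ n"
proof -
  show fst_0: "fst (((\<lambda>w. mat_br w q) ^^ n) w) = 0" for n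
    by (induction n) (simp_all add: assms)
  show "Poly_Mapping.lookup (snd (((\<lambda>w. mat_br w q) ^^ n) w)) i
      = Poly_Mapping.lookup (snd w) i * fst q ^ n"
    by (induction n) (simp_all add: fst_0 mult_ac)
qed

text \<open>Repeated multiplication by an element \<open>q\<close> of the ideal acts on the strictly upper triangular
  matrices as multiplication by powers of \<open>fst q\<close>, so \<open>fst q\<close> vanishes.\<close>

lemma nilpotent_ideal_subset_strictly_upper:
  assumes T: "lie_subalgebra mat_scale mat_br M T" and t: "t \<in> strictly_upper T" "t \<noteq> 0"
    and K: "nilpotent_ideal mat_scale mat_br T K"
  shows "K \<subseteq> strictly_upper T"
proof
  fix q assume "q \<in> K"
  interpret lie_algebra_on mat_scale mat_br T
    by unfold_locales (rule lie_algebra_mat [OF T])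
  have t_T: "t \<in> T" "fst t = 0"
    using t(1) by (simp_all add: strictly_upper_def)
  obtain n where n: "lower_central mat_scale mat_br K n = {0}"
    using K by (auto simp: nilpotent_ideal_def)
  obtain i where i: "Poly_Mapping.lookup (snd t) i \<noteq> 0"
    using t(2) t_T(2) by (metis mat_eqI fst_zero snd_zero lookup_zero)
  have "q \<in> T" "mat_br q t \<in> K"
    using K \<open>q \<in> K\<close> t_T(1) by (auto simp: nilpotent_ideal_def lie_ideal_def)
  then have "((\<lambda>w. mat_br w q) ^^ n) (mat_br q t) = 0"
    using funpow_br_in_lower_central [OF _ \<open>q \<in> K\<close>, of "mat_br q t" n] n by simp
  then have "Poly_Mapping.lookup (snd t) i * fst q ^ Suc n = 0"
    using funpow_mat_br(2) [of "mat_br q t" n q i] t_T(2) by (simp add: mult.assoc)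
  then have "fst q = 0"
    using i by (metis mpoly_mult_eq_0_iff mpoly_power_eq_0)
  with \<open>q \<in> T\<close> show "q \<in> strictly_upper T"
    by (simp add: strictly_upper_def)
qed

lemma fitting_mat:
  assumes T: "lie_subalgebra mat_scale mat_br M T" and "strictly_upper T \<noteq> {0}"
  shows "fitting mat_scale mat_br T = strictly_upper T"
proof -
  interpret lie_algebra_on mat_scale mat_br T
    by unfold_locales (rule lie_algebra_mat [OF T])
  note ideal = lie_ideal_strictly_upper [OF T]
  then have "0 \<in> strictly_upper T"
    by (simp add: lie_ideal_def mat.subspace_0)
  then obtain t where "t \<in> strictly_upper T" "t \<noteq> 0"
    using assms(2) by blast
  then show ?thesis
    using fitting_eqI [OF nilpotent_ideal_of_abelian [OF ideal abelian_strictly_upper]]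
      nilpotent_ideal_subset_strictly_upper [OF T] by blast
qed

definition mat_poly_act :: "('i, 'l, 'k::field) mat_elem \<Rightarrow> (('i, 'l, 'k) mat_elem, 'k) mpoly
    \<Rightarrow> ('i, 'l, 'k) mat_elem" where
  "mat_poly_act v f = (0, Poly_Mapping.map (\<lambda>r. r * poly_subst fst f) (snd v))"

lemma fst_mat_poly_act [simp]: "fst (mat_poly_act v f) = 0"
  and lookup_mat_poly_act [simp]: "Poly_Mapping.lookup (snd (mat_poly_act v f)) i
    = Poly_Mapping.lookup (snd v) i * poly_subst fst f"
  by (simp_all add: mat_poly_act_def lookup_map)

lemma mat_poly_act_closed:
  assumes T: "lie_subalgebra mat_scale mat_br M T" and "B \<subseteq> T"
    and v: "v \<in> T" "fst v = 0" and f: "f \<in> polys_in B"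
  shows "mat_poly_act v f \<in> T"
  using f
proof (induction rule: polys_in_induct)
  case (const c)
  have "mat_poly_act v (pconst c) = mat_scale c v"
    using v(2) by (auto intro!: mat_eqI simp: mult.commute)
  then show ?case
    using v(1) T by (simp add: lie_subalgebra_def mat.subspace_scale)
next
  case (add p q)
  have "mat_poly_act v (p + q) = mat_poly_act v p + mat_poly_act v q"
    by (auto intro!: mat_eqI simp: lookup_add poly_subst_add algebra_simps)
  then show ?case
    using add T by (simp add: lie_subalgebra_def mat.subspace_add)
next
  case (mult_var p b)
  have "mat_poly_act v (p * pvar b) = mat_br (mat_poly_act v p) b"
    by (auto intro!: mat_eqI simp: poly_subst_mult algebra_simps)
  then show ?case
    using mult_var \<open>B \<subseteq> T\<close> T by (auto simp: lie_subalgebra_def)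
qed

lemma poly_action_mat:
  assumes "lie_subalgebra mat_scale mat_br M T" "B \<subseteq> T"
  shows "poly_action mat_scale mat_br (strictly_upper T) B mat_poly_act"
  unfolding poly_action_def strictly_upper_def using mat_poly_act_closed [OF assms]
  by (auto intro!: mat_eqI simp: lookup_add poly_subst_add poly_subst_mult algebra_simps)

lemma inj_on_poly_subst_fst:
  fixes T :: "('i, 'l, 'k::field) mat_elem set"
  assumes T: "lie_subalgebra mat_scale mat_br (matM0 I \<Lambda>) T"
    and B: "quotient_basis mat_scale T (strictly_upper T) B"
  shows "inj_on (poly_subst fst) (polys_in B)"
proof (rule inj_on_poly_subst_independent)
  interpret vector_space_pair "mat_scale :: 'k \<Rightarrow> ('i, 'l, 'k) mat_elem \<Rightarrow> _"
      "poly_scale :: 'k \<Rightarrow> ('l, 'k) mpoly \<Rightarrow> _"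
    by unfold_locales
  have linear_fst: "Vector_Spaces.linear mat_scale poly_scale (fst :: ('i, 'l, 'k) mat_elem \<Rightarrow> _)"
    by (simp add: Vector_Spaces.linear_iff mat.vector_space_axioms mpoly.vector_space_axioms)
  have "mat.subspace T" and TM: "T \<subseteq> matM0 I \<Lambda>"
    using T by (simp_all add: lie_subalgebra_def)
  moreover have "mat.subspace (strictly_upper T)"
    using lie_ideal_strictly_upper [OF T] by (simp add: lie_ideal_def)
  ultimately show "inj_on fst B" "mpoly.independent (fst ` B)"
    using inj_on_quotient_basis [OF B _ _ linear_fst]
      independent_image_quotient_basis [OF B _ _ linear_fst]
    by (auto simp: strictly_upper_def)
  show "fst ` B \<subseteq> linear_forms \<Lambda>"
    using B TM by (auto simp: quotient_basis_def matM0_iff)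
qed

lemma torsion_free_action_mat:
  assumes T: "lie_subalgebra mat_scale mat_br (matM0 I \<Lambda>) T"
    and B: "quotient_basis mat_scale T (strictly_upper T) B"
  shows "torsion_free_action (strictly_upper T) B mat_poly_act"
  unfolding torsion_free_action_def
proof (intro ballI impI)
  fix v f assume v: "v \<in> strictly_upper T" and f: "f \<in> polys_in B" and "mat_poly_act v f = 0"
  then have entry_or_subst_0: "Poly_Mapping.lookup (snd v) i = 0 \<or> poly_subst fst f = 0" for i
    by (metis lookup_mat_poly_act lookup_zero mpoly_mult_eq_0_iff snd_zero)
  show "v = 0 \<or> f = 0"
  proof (cases "poly_subst fst f = 0")
    case True
    then have "f = 0"
      using inj_onD [OF inj_on_poly_subst_fst [OF T B] _ f, of 0] by simp
    then show ?thesis ..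
  next
    case False
    then have "v = 0"
      using entry_or_subst_0 v by (intro mat_eqI) (simp_all add: strictly_upper_def)
    then show ?thesis ..
  qed
qed

theorem U_algebra_subalgebra_matM0:
  assumes T: "lie_subalgebra mat_scale mat_br (matM0 I \<Lambda>) T"
  shows "U_algebra mat_scale mat_br T"
proof -
  interpret lie_algebra_on mat_scale mat_br T
    by unfold_locales (rule lie_algebra_mat [OF T])
  show ?thesis
  proof (cases "strictly_upper T = {0}")
    case True
    have "mat_br x y \<in> strictly_upper T" if "x \<in> T" "y \<in> T" for x y
      using that by (simp add: strictly_upper_def br_closed)
    then show ?thesis
      using True by (intro U_algebra_of_abelian) (auto simp: abelian_set_def)
  next
    case False
    note fitting = fitting_mat [OF T False]
    show ?thesis
    proof (rule U_algebraI)
      fix B assume B: "quotient_basis mat_scale T (fitting mat_scale mat_br T) B"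
      then have "B \<subseteq> T"
        by (simp add: quotient_basis_def)
      then show "\<exists>act. poly_action mat_scale mat_br (fitting mat_scale mat_br T) B act
          \<and> torsion_free_action (fitting mat_scale mat_br T) B act"
        using poly_action_mat [OF T] torsion_free_action_mat [OF T] B by (auto simp: fitting)
    qed (simp_all add: fitting abelian_strictly_upper metabelian_mat [OF T])
  qed
qed

section \<open>Finitely generated submodules of a torsion-free module\<close>

locale torsion_free_poly_module = vector_space sc
  for sc :: "'k::field \<Rightarrow> 'a::ab_group_add \<Rightarrow> 'a" +
  fixes br :: "'a \<Rightarrow> 'a \<Rightarrow> 'a" and M B :: "'a set" and act :: "'a \<Rightarrow> ('a, 'k) mpoly \<Rightarrow> 'a"
  assumes module_subspace: "subspace M"
    and poly_action: "poly_action sc br M B act"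
    and torsion_free: "torsion_free_action M B act"
begin

abbreviation R :: "('a, 'k) mpoly set" where "R \<equiv> polys_in B"

lemmas act_closed = poly_actionD(1) [OF poly_action]
  and act_1 = poly_actionD(2) [OF poly_action]
  and act_pvar = poly_actionD(3) [OF poly_action]
  and act_add_right = poly_actionD(4) [OF poly_action]
  and act_pconst_mult = poly_actionD(5) [OF poly_action]
  and act_add_left = poly_actionD(6) [OF poly_action]
  and act_scale_left = poly_actionD(7) [OF poly_action]
  and act_mult = poly_actionD(8) [OF poly_action]
  and act_pconst = poly_action_pconst [OF poly_action]

lemma act_0_right: "v \<in> M \<Longrightarrow> act v 0 = 0"
  using act_pconst [of v 0] by simp

lemma act_0_left: "f \<in> R \<Longrightarrow> act 0 f = 0"
  using act_scale_left [of 0 f 0] subspace_0 [OF module_subspace] by simp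

lemma act_sum_left:
  "f \<in> R \<Longrightarrow> (\<And>i. i \<in> I \<Longrightarrow> v i \<in> M) \<Longrightarrow> act (sum v I) f = (\<Sum>i\<in>I. act (v i) f)"
proof (induction I rule: infinite_finite_induct)
  case (insert i I)
  then have "sum v I \<in> M"
    by (intro subspace_sum [OF module_subspace]) auto
  with insert show ?case
    by (simp add: act_add_left)
qed (simp_all add: act_0_left)

lemma act_commute: "v \<in> M \<Longrightarrow> f \<in> R \<Longrightarrow> g \<in> R \<Longrightarrow> act (act v f) g = act (act v g) f"
  by (simp add: mult.commute flip: act_mult)

lemma act_eq_0D: "act v f = 0 \<Longrightarrow> v \<in> M \<Longrightarrow> f \<in> R \<Longrightarrow> f \<noteq> 0 \<Longrightarrow> v = 0"
  using torsion_free unfolding torsion_free_action_def by blast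

text \<open>Only finite \<open>E\<close> are meant here: for infinite \<open>E\<close> the sum is \<open>0\<close>.\<close>

definition lincomb :: "'a set \<Rightarrow> ('a \<Rightarrow> ('a, 'k) mpoly) \<Rightarrow> 'a" where
  "lincomb E c = (\<Sum>e\<in>E. act e (c e))"

lemma lincomb_add:
  assumes "E \<subseteq> M" "\<forall>e\<in>E. c e \<in> R" "\<forall>e\<in>E. d e \<in> R"
  shows "lincomb E (\<lambda>e. c e + d e) = lincomb E c + lincomb E d"
  using assms by (simp add: lincomb_def act_add_right subset_iff flip: sum.distrib)

lemma lincomb_diff:
  assumes "E \<subseteq> M" "\<forall>e\<in>E. c e \<in> R" "\<forall>e\<in>E. d e \<in> R"
  shows "lincomb E (\<lambda>e. c e - d e) = lincomb E c - lincomb E d"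
  using lincomb_add [of E "\<lambda>e. c e - d e" d] assms by simp

lemma act_lincomb:
  assumes "E \<subseteq> M" "\<forall>e\<in>E. c e \<in> R" "f \<in> R"
  shows "act (lincomb E c) f = lincomb E (\<lambda>e. c e * f)"
  using assms by (simp add: lincomb_def act_sum_left act_mult act_closed subset_iff)

definition act_span :: "'a set \<Rightarrow> 'a set" where
  "act_span E = {lincomb E c | c. \<forall>e\<in>E. c e \<in> R}"

lemma act_spanI: "\<forall>e\<in>E. c e \<in> R \<Longrightarrow> lincomb E c \<in> act_span E"
  unfolding act_span_def by blast

lemma act_spanE:
  assumes "v \<in> act_span E"
  obtains c where "v = lincomb E c" "\<forall>e\<in>E. c e \<in> R"
  using assms unfolding act_span_def by blast

lemma act_span_subset: "E \<subseteq> M \<Longrightarrow> act_span E \<subseteq> M"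
  by (auto simp: lincomb_def elim!: act_spanE intro!: subspace_sum [OF module_subspace] act_closed)

lemma act_span_act:
  assumes "E \<subseteq> M" "v \<in> act_span E" "f \<in> R"
  shows "act v f \<in> act_span E"
proof -
  obtain c where "v = lincomb E c" "\<forall>e\<in>E. c e \<in> R"
    using assms(2) by (rule act_spanE)
  then show ?thesis
    using assms(1,3) act_spanI [of E "\<lambda>e. c e * f"] by (simp add: act_lincomb)
qed

lemma act_span_subspace:
  assumes "E \<subseteq> M"
  shows "subspace (act_span E)"
proof (rule subspaceI)
  have "lincomb E (\<lambda>_. 0) = 0"
    using assms by (simp add: lincomb_def act_0_right subset_iff)
  then show "0 \<in> act_span E"
    using act_spanI [of E "\<lambda>_. 0"] by simp
  show "v + w \<in> act_span E" if "v \<in> act_span E" "w \<in> act_span E" for v w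
  proof -
    obtain c where c: "v = lincomb E c" "\<forall>e\<in>E. c e \<in> R"
      using \<open>v \<in> act_span E\<close> by (rule act_spanE)
    obtain d where d: "w = lincomb E d" "\<forall>e\<in>E. d e \<in> R"
      using \<open>w \<in> act_span E\<close> by (rule act_spanE)
    have "lincomb E (\<lambda>e. c e + d e) \<in> act_span E"
      using c(2) d(2) by (intro act_spanI) simp
    then show ?thesis
      using c d assms by (simp add: lincomb_add)
  qed
  show "sc a v \<in> act_span E" if "v \<in> act_span E" for a v
    using act_span_act [OF assms that, of "pconst a"] act_pconst act_span_subset [OF assms] that
    by auto
qed

lemma act_span_base:
  assumes "finite E" "E \<subseteq> M" "e \<in> E"
  shows "e \<in> act_span E"
proof -
  let ?c = "\<lambda>x. if x = e then 1 else 0"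
  have "lincomb E ?c = (\<Sum>x\<in>E. if x = e then e else 0)"
    unfolding lincomb_def using assms by (intro sum.cong) (auto simp: act_1 act_0_right)
  then have "lincomb E ?c = e"
    using assms by simp
  then show ?thesis
    using act_spanI [of E ?c] by simp
qed

definition act_independent :: "'a set \<Rightarrow> bool" where
  "act_independent E \<longleftrightarrow> (\<forall>c. (\<forall>e\<in>E. c e \<in> R) \<longrightarrow> lincomb E c = 0 \<longrightarrow> (\<forall>e\<in>E. c e = 0))"

lemma act_independentD:
  "act_independent E \<Longrightarrow> lincomb E c = 0 \<Longrightarrow> (\<And>e. e \<in> E \<Longrightarrow> c e \<in> R) \<Longrightarrow> e \<in> E \<Longrightarrow> c e = 0"
  unfolding act_independent_def by blast

lemma exists_multiple_in_act_span:
  assumes E: "finite E" "act_independent E" and g: "\<not> act_independent (insert g E)"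
    and M: "insert g E \<subseteq> M"
  shows "\<exists>r\<in>R. r \<noteq> 0 \<and> act g r \<in> act_span E"
proof -
  have "g \<notin> E"
    using E(2) g by (auto simp: insert_absorb)
  obtain c where c: "\<forall>e\<in>insert g E. c e \<in> R" "lincomb (insert g E) c = 0" "\<exists>e\<in>insert g E. c e \<noteq> 0"
    using g unfolding act_independent_def by blast
  have relation: "act g (c g) + lincomb E c = 0"
    using c(2) E(1) \<open>g \<notin> E\<close> by (simp add: lincomb_def)
  have "c g \<noteq> 0"
  proof
    assume "c g = 0"
    then have "lincomb E c = 0"
      using relation M by (simp add: act_0_right)
    then show False
      using act_independentD [OF E(2)] c(1,3) \<open>c g = 0\<close> by blast
  qed
  moreover have "lincomb E c \<in> act_span E"
    using c(1) by (intro act_spanI) simp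
  then have "act g (c g) \<in> act_span E"
    using relation subspace_neg [OF act_span_subspace, of E] M
    by (simp add: eq_neg_iff_add_eq_0 [symmetric])
  ultimately show ?thesis
    using c(1) by blast
qed

lemma exists_common_multiple:
  assumes "finite G" "G \<subseteq> M" "\<And>g. g \<in> G \<Longrightarrow> \<exists>r\<in>R. r \<noteq> 0 \<and> act g r \<in> U"
    and U: "\<And>v f. v \<in> U \<Longrightarrow> f \<in> R \<Longrightarrow> act v f \<in> U"
  shows "\<exists>r\<in>R. r \<noteq> 0 \<and> (\<forall>g\<in>G. act g r \<in> U)"
  using assms(1-3)
proof (induction G rule: finite_induct)
  case (insert g G)
  obtain r where r: "r \<in> R" "r \<noteq> 0" "\<forall>g\<in>G. act g r \<in> U"
    using insert by auto
  obtain s where s: "s \<in> R" "s \<noteq> 0" "act g s \<in> U"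
    using insert.prems(2) [of g] by auto
  have "act x (r * s) \<in> U" if x: "x \<in> insert g G" for x
  proof -
    have "x \<in> M"
      using x insert.prems(1) by blast
    then have "act x (r * s) = act (act x r) s" "act x (r * s) = act (act x s) r"
      using r(1) s(1) by (simp_all add: act_mult act_commute)
    then show ?thesis
      using x r s U by (metis insertE)
  qed
  moreover have "r * s \<in> R" "r * s \<noteq> 0"
    using r s by (simp_all add: mpoly_mult_eq_0_iff)
  ultimately show ?case
    by blast
qed (auto intro: bexI [of _ 1])

lemma exists_maximal_act_independent:
  assumes "finite G"
  obtains E where "E \<subseteq> G" "act_independent E" "\<And>g. g \<in> G - E \<Longrightarrow> \<not> act_independent (insert g E)"
proof -
  have "finite {E. E \<subseteq> G \<and> act_independent E}" "{E. E \<subseteq> G \<and> act_independent E} \<noteq> {}"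
    using assms by (auto simp: act_independent_def)
  from finite_has_maximal [OF this] obtain E where "E \<subseteq> G" "act_independent E"
    and "\<And>E'. E' \<subseteq> G \<Longrightarrow> act_independent E' \<Longrightarrow> E \<subseteq> E' \<Longrightarrow> E = E'"
    by auto
  then show thesis
    by (intro that) blast+
qed

lemma act_in_act_span:
  assumes "E \<subseteq> M" "G \<subseteq> M" and r: "r \<in> R" "\<forall>g\<in>G. act g r \<in> act_span E" and "v \<in> act_span G"
  shows "act v r \<in> act_span E"
proof -
  obtain c where c: "v = lincomb G c" "\<forall>g\<in>G. c g \<in> R"
    using \<open>v \<in> act_span G\<close> by (rule act_spanE)
  have "act g (c g * r) \<in> act_span E" if "g \<in> G" for g
  proof -
    have "act g (c g * r) = act (act g r) (c g)"
      using act_mult [of g r "c g"] that \<open>G \<subseteq> M\<close> r(1) c(2) by (auto simp: mult.commute)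
    then show ?thesis
      using act_span_act [OF \<open>E \<subseteq> M\<close>] r(2) c(2) that by simp
  qed
  then have "lincomb G (\<lambda>g. c g * r) \<in> act_span E"
    unfolding lincomb_def by (rule subspace_sum [OF act_span_subspace [OF \<open>E \<subseteq> M\<close>]])
  then show ?thesis
    using act_lincomb [OF \<open>G \<subseteq> M\<close> c(2) r(1)] c(1) by simp
qed

lemma exists_common_denominator:
  assumes G: "finite G" "G \<subseteq> M"
  obtains E r where "E \<subseteq> G" "act_independent E" "r \<in> R" "r \<noteq> 0"
    "\<forall>v\<in>act_span G. act v r \<in> act_span E"
proof -
  obtain E where E: "E \<subseteq> G" "act_independent E"
    and maximal: "\<And>g. g \<in> G - E \<Longrightarrow> \<not> act_independent (insert g E)"
    using exists_maximal_act_independent [OF G(1)] by blast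
  have EM: "E \<subseteq> M" and "finite E"
    using E(1) G by (auto intro: finite_subset)
  have "\<exists>r\<in>R. r \<noteq> 0 \<and> act g r \<in> act_span E" if "g \<in> G" for g
  proof (cases "g \<in> E")
    case True
    then have "act g 1 \<in> act_span E"
      using act_span_base [OF \<open>finite E\<close> EM] EM act_1 by auto
    then show ?thesis
      by (intro bexI [of _ 1]) simp_all
  next
    case False
    then show ?thesis
      using exists_multiple_in_act_span [OF \<open>finite E\<close> E(2)] maximal that EM G(2) by auto
  qed
  then obtain r where r: "r \<in> R" "r \<noteq> 0" "\<forall>g\<in>G. act g r \<in> act_span E"
    using exists_common_multiple [OF G _ act_span_act [OF EM]] by blast
  then show thesis
    using act_in_act_span [OF EM G(2)] by (intro that [OF E r(1,2)]) blast
qed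

definition has_coords :: "'a set \<Rightarrow> ('a \<Rightarrow> 'i) \<Rightarrow> 'a \<Rightarrow> ('i \<Rightarrow>\<^sub>0 ('a, 'k) mpoly) \<Rightarrow> bool" where
  "has_coords E h v c \<longleftrightarrow> Poly_Mapping.keys c \<subseteq> h ` E \<and> (\<forall>i. Poly_Mapping.lookup c i \<in> R)
    \<and> v = lincomb E (\<lambda>e. Poly_Mapping.lookup c (h e))"

lemma exists_has_coords:
  assumes "finite E" "inj_on h E" "v \<in> act_span E"
  shows "\<exists>c. has_coords E h v c"
proof -
  obtain c where c: "v = lincomb E c" "\<forall>e\<in>E. c e \<in> R"
    using assms(3) by (rule act_spanE)
  define d where "d = Abs_poly_mapping (\<lambda>i. if i \<in> h ` E then c (inv_into E h i) else 0)"
  have "finite {i. (if i \<in> h ` E then c (inv_into E h i) else 0) \<noteq> 0}"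
    by (rule finite_subset [of _ "h ` E"]) (use assms(1) in auto)
  then have lookup_d:
    "Poly_Mapping.lookup d i = (if i \<in> h ` E then c (inv_into E h i) else 0)" for i
    by (simp add: d_def)
  have "has_coords E h v d"
    unfolding has_coords_def
    using assms(2) c by (auto simp: in_keys_iff lookup_d lincomb_def split: if_splits)
  then show ?thesis ..
qed

lemma has_coords_unique:
  assumes E: "act_independent E" "E \<subseteq> M" and c: "has_coords E h v c" and d: "has_coords E h v d"
  shows "c = d"
proof (rule poly_mapping_eqI)
  fix i
  have R: "Poly_Mapping.lookup c j \<in> R" "Poly_Mapping.lookup d j \<in> R" for j
    using c d by (simp_all add: has_coords_def)
  then have "lincomb E (\<lambda>e. Poly_Mapping.lookup c (h e) - Poly_Mapping.lookup d (h e)) = 0"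
    using lincomb_diff [OF E(2)] c d by (simp add: has_coords_def)
  from act_independentD [OF E(1) this]
  have "Poly_Mapping.lookup c (h e) = Poly_Mapping.lookup d (h e)" if "e \<in> E" for e
    using R that by simp
  moreover have "Poly_Mapping.lookup c i = 0" "Poly_Mapping.lookup d i = 0" if "i \<notin> h ` E"
    using c d that by (auto simp: has_coords_def in_keys_iff)
  ultimately show "Poly_Mapping.lookup c i = Poly_Mapping.lookup d i"
    by (cases "i \<in> h ` E") auto
qed

lemma has_coords_add:
  assumes "E \<subseteq> M" "has_coords E h v c" "has_coords E h w d"
  shows "has_coords E h (v + w) (c + d)"
  using assms keys_add [of c d] unfolding has_coords_def by (auto simp: lookup_add lincomb_add)

lemma has_coords_act:
  assumes "E \<subseteq> M" "has_coords E h v c" "f \<in> R"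
  shows "has_coords E h (act v f) (Poly_Mapping.map (\<lambda>r. r * f) c)"
proof -
  have "Poly_Mapping.keys (Poly_Mapping.map (\<lambda>r. r * f) c) \<subseteq> Poly_Mapping.keys c"
    by (auto simp: in_keys_iff lookup_map)
  with assms show ?thesis
    unfolding has_coords_def by (auto simp: lookup_map act_lincomb)
qed

definition free_embedding :: "'a set \<Rightarrow> ('a \<Rightarrow> 'i \<Rightarrow>\<^sub>0 ('a, 'k) mpoly) \<Rightarrow> bool" where
  "free_embedding N \<psi> \<longleftrightarrow> (\<forall>v\<in>N. \<forall>i. Poly_Mapping.lookup (\<psi> v) i \<in> R)
    \<and> (\<forall>v\<in>N. \<forall>w\<in>N. \<psi> (v + w) = \<psi> v + \<psi> w)
    \<and> (\<forall>v\<in>N. \<forall>f\<in>R. \<psi> (act v f) = Poly_Mapping.map (\<lambda>r. r * f) (\<psi> v))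
    \<and> (\<forall>v\<in>N. \<psi> v = 0 \<longrightarrow> v = 0)"

lemma free_embeddingD:
  assumes "free_embedding N \<psi>" "v \<in> N"
  shows "Poly_Mapping.lookup (\<psi> v) i \<in> R"
    and "w \<in> N \<Longrightarrow> \<psi> (v + w) = \<psi> v + \<psi> w"
    and "f \<in> R \<Longrightarrow> Poly_Mapping.lookup (\<psi> (act v f)) i = Poly_Mapping.lookup (\<psi> v) i * f"
    and "\<psi> v = 0 \<Longrightarrow> v = 0"
  using assms by (simp_all add: free_embedding_def lookup_map)

lemma free_embedding_of_coords:
  assumes E: "act_independent E" "E \<subseteq> M" and G: "G \<subseteq> M" and r: "r \<in> R" "r \<noteq> 0"
    and \<psi>: "\<And>v. v \<in> act_span G \<Longrightarrow> has_coords E h (act v r) (\<psi> v)"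
  shows "free_embedding (act_span G) \<psi>"
  unfolding free_embedding_def
proof (intro conjI ballI allI impI)
  have GM: "v \<in> M" if "v \<in> act_span G" for v
    using act_span_subset [OF G] that by blast
  fix v assume v: "v \<in> act_span G"
  show "Poly_Mapping.lookup (\<psi> v) i \<in> R" for i
    using \<psi> [OF v] by (simp add: has_coords_def)
  show "\<psi> (v + w) = \<psi> v + \<psi> w" if w: "w \<in> act_span G" for w
  proof (rule has_coords_unique [OF E])
    show "has_coords E h (act (v + w) r) (\<psi> (v + w))"
      using \<psi> subspace_add [OF act_span_subspace [OF G] v w] by blast
    show "has_coords E h (act (v + w) r) (\<psi> v + \<psi> w)"
      using has_coords_add [OF E(2) \<psi> [OF v] \<psi> [OF w]] GM v w r(1) by (simp add: act_add_left)
  qed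
  show "\<psi> (act v f) = Poly_Mapping.map (\<lambda>r. r * f) (\<psi> v)" if f: "f \<in> R" for f
  proof (rule has_coords_unique [OF E])
    show "has_coords E h (act (act v f) r) (\<psi> (act v f))"
      using \<psi> act_span_act [OF G v f] by blast
    show "has_coords E h (act (act v f) r) (Poly_Mapping.map (\<lambda>r. r * f) (\<psi> v))"
      using has_coords_act [OF E(2) \<psi> [OF v] f] act_commute [OF GM [OF v] f r(1)] by simp
  qed
  show "v = 0" if "\<psi> v = 0"
  proof (rule act_eq_0D [OF _ GM [OF v] r])
    have "act v r = lincomb E (\<lambda>_. 0)"
      using \<psi> [OF v] that by (simp add: has_coords_def)
    then show "act v r = 0"
      using E(2) by (simp add: lincomb_def act_0_right subset_iff)
  qed
qed

text \<open>Multiplication by a common denominator moves the module into the span of a maximal independent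
  set \<open>E\<close> of generators, where coordinates can be read off.\<close>

theorem exists_free_embedding:
  assumes G: "finite G" "G \<subseteq> M"
  shows "\<exists>\<psi> :: 'a \<Rightarrow> nat \<Rightarrow>\<^sub>0 ('a, 'k) mpoly. free_embedding (act_span G) \<psi>"
proof -
  obtain E r where E: "E \<subseteq> G" "act_independent E" and r: "r \<in> R" "r \<noteq> 0"
    and denominator: "\<forall>v\<in>act_span G. act v r \<in> act_span E"
    by (rule exists_common_denominator [OF G])
  have EM: "E \<subseteq> M" and "finite E"
    using E(1) G by (auto intro: finite_subset)
  obtain h :: "'a \<Rightarrow> nat" where "inj_on h E"
    using finite_imp_inj_to_nat_seg [OF \<open>finite E\<close>] by blast
  then have "\<forall>v\<in>act_span G. \<exists>c. has_coords E h (act v r) c"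
    using exists_has_coords [OF \<open>finite E\<close>] denominator by blast
  then obtain \<psi> where "\<And>v. v \<in> act_span G \<Longrightarrow> has_coords E h (act v r) (\<psi> v)"
    by metis
  then have "free_embedding (act_span G) \<psi>"
    by (rule free_embedding_of_coords [OF E(2) EM G(2) r])
  then show ?thesis
    by blast
qed

end

section \<open>Embeddings and derivations\<close>

lemma (in lie_algebra_on) lie_embeddingI:
  assumes add: "\<And>x y. x \<in> A \<Longrightarrow> y \<in> A \<Longrightarrow> \<phi> (x + y) = \<phi> x + \<phi> y"
    and scale: "\<And>c x. x \<in> A \<Longrightarrow> \<phi> (sc c x) = sc' c (\<phi> x)"
    and bracket: "\<And>x y. x \<in> A \<Longrightarrow> y \<in> A \<Longrightarrow> \<phi> (br x y) = br' (\<phi> x) (\<phi> y)"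
    and kernel: "\<And>x. x \<in> A \<Longrightarrow> \<phi> x = 0 \<Longrightarrow> x = 0"
  shows "lie_embedding sc br A sc' br' \<phi>"
proof -
  have "inj_on \<phi> A"
  proof (rule inj_onI)
    fix x y assume xy: "x \<in> A" "y \<in> A" "\<phi> x = \<phi> y"
    have "\<phi> (x - y) + \<phi> y = \<phi> x"
      using add [of "x - y" y] carrier_diff [OF xy(1,2)] xy(2) by simp
    then show "x = y"
      using kernel [of "x - y"] carrier_diff [OF xy(1,2)] xy(3) by simp
  qed
  with add scale bracket show ?thesis
    unfolding lie_embedding_def by blast
qed

lemma lie_embedding_comp:
  assumes "lie_embedding sc1 br1 A sc2 br2 \<phi>" "\<phi> ` A \<subseteq> A'" "lie_embedding sc2 br2 A' sc3 br3 \<chi>"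
  shows "lie_embedding sc1 br1 A sc3 br3 (\<chi> \<circ> \<phi>)"
proof -
  have "inj_on (\<chi> \<circ> \<phi>) A"
    using assms by (auto simp: lie_embedding_def intro: comp_inj_on inj_on_subset)
  with assms show ?thesis
    unfolding lie_embedding_def by (auto simp: image_subset_iff)
qed

definition lie_derivation ::
    "('k::field \<Rightarrow> 'a::ab_group_add \<Rightarrow> 'a) \<Rightarrow> ('a \<Rightarrow> 'a \<Rightarrow> 'a) \<Rightarrow> 'a set \<Rightarrow> ('a \<Rightarrow> 'a) \<Rightarrow> bool" where
  "lie_derivation sc br A D \<longleftrightarrow> (\<forall>x\<in>A. D x \<in> A)
    \<and> (\<forall>x\<in>A. \<forall>y\<in>A. D (x + y) = D x + D y)
    \<and> (\<forall>c. \<forall>x\<in>A. D (sc c x) = sc c (D x))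
    \<and> (\<forall>x\<in>A. \<forall>y\<in>A. D (br x y) = br (D x) y + br x (D y))"

lemma (in lie_algebra_on) lie_derivation_inner:
  assumes "b \<in> A"
  shows "lie_derivation sc br A (\<lambda>x. br x b)"
proof -
  have "br (br x y) b = br (br x b) y + br x (br y b)" if "x \<in> A" "y \<in> A" for x y
  proof -
    have "br (br x b) y = br y (br b x)"
      using that assms br_anti [of x b] br_anti [of y "br b x"]
      by (simp add: br_closed br_minus_left)
    moreover have "br (br x y) b = - br b (br x y)"
      using that assms by (intro br_anti br_closed)
    moreover have "br x (br y b) + br y (br b x) = - br b (br x y)"
      using jacobi [OF that assms] by (simp add: eq_neg_iff_add_eq_0)
    ultimately show ?thesis
      by (simp add: add.commute)
  qed
  then show ?thesis
    using assms by (simp add: lie_derivation_def br_closed br_add_left br_scale_left)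
qed

definition mat_subst ::
    "('l \<Rightarrow> ('m, 'k) mpoly) \<Rightarrow> ('i, 'l, 'k::field) mat_elem \<Rightarrow> ('i, 'm, 'k) mat_elem" where
  "mat_subst \<sigma> p = (poly_subst \<sigma> (fst p), Poly_Mapping.map (poly_subst \<sigma>) (snd p))"

lemma fst_mat_subst [simp]: "fst (mat_subst \<sigma> p) = poly_subst \<sigma> (fst p)"
  and lookup_mat_subst [simp]:
    "Poly_Mapping.lookup (snd (mat_subst \<sigma> p)) i = poly_subst \<sigma> (Poly_Mapping.lookup (snd p) i)"
  by (simp_all add: mat_subst_def lookup_map)

lemma lie_embedding_mat_subst:
  assumes "inj_on (poly_subst \<sigma>) (polys_in \<Lambda>)"
  shows "lie_embedding mat_scale mat_br (matM I \<Lambda>) mat_scale mat_br (mat_subst \<sigma>)"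
proof -
  have "inj_on (mat_subst \<sigma>) (matM I \<Lambda>)"
  proof (rule inj_onI)
    fix p q assume "p \<in> matM I \<Lambda>" "q \<in> matM I \<Lambda>" and eq: "mat_subst \<sigma> p = mat_subst \<sigma> q"
    then have "fst p \<in> polys_in \<Lambda>" "fst q \<in> polys_in \<Lambda>"
      and "Poly_Mapping.lookup (snd p) i \<in> polys_in \<Lambda>"
        "Poly_Mapping.lookup (snd q) i \<in> polys_in \<Lambda>" for i
      by (simp_all add: matM_def)
    with eq show "p = q"
      by (metis mat_eqI fst_mat_subst lookup_mat_subst inj_onD [OF assms])
  qed
  then show ?thesis
    unfolding lie_embedding_def
    by (auto intro!: mat_eqI simp: lookup_add poly_subst_add poly_subst_diff poly_subst_mult)
qed

lemma mat_subst_rename_matM0: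
  fixes p :: "('i, 'l, 'k::field) mat_elem" and h :: "'l \<Rightarrow> 'm"
  assumes "p \<in> matM0 I \<Lambda>"
  shows "mat_subst (\<lambda>v. pvar (h v)) p \<in> matM0 I (h ` \<Lambda>)" (is "?q \<in> _")
proof -
  have p: "fst p \<in> linear_forms \<Lambda>" "Poly_Mapping.keys (snd p) \<subseteq> I"
    "Poly_Mapping.lookup (snd p) i \<in> polys_in \<Lambda>" for i
    using assms by (simp_all add: matM0_iff)
  have "fst ?q \<in> linear_forms (h ` \<Lambda>)"
    using poly_subst_rename_linear_forms [OF p(1), of h] by simp
  moreover have "Poly_Mapping.lookup (snd ?q) i \<in> polys_in (h ` \<Lambda>)" for i
    unfolding lookup_mat_subst by (rule poly_subst_in_polys_in [OF p(3)]) simp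
  moreover have "Poly_Mapping.keys (snd ?q) \<subseteq> Poly_Mapping.keys (snd p)"
    by (auto simp: in_keys_iff)
  ultimately show ?thesis
    using p(2) by (simp add: matM0_iff)
qed

section \<open>Embedding a finitely generated U-algebra\<close>

locale torsion_free_extension = lie_algebra_on sc br A + torsion_free_poly_module sc br F B act
  for sc :: "'k::field \<Rightarrow> 'a::ab_group_add \<Rightarrow> 'a" and br A F B act +
  assumes ideal: "lie_ideal sc br A F"
    and abelian: "abelian_set br F"
    and br_in_F: "a \<in> A \<Longrightarrow> b \<in> A \<Longrightarrow> br a b \<in> F"
    and basis: "quotient_basis sc A F B"
begin

lemma F_subset: "F \<subseteq> A"
  using ideal by (simp add: lie_ideal_def)

lemma B_subset: "B \<subseteq> A" and carrier_subset_span: "A \<subseteq> span (B \<union> F)"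
  using basis by (simp_all add: quotient_basis_def)

definition linear_form :: "'a \<Rightarrow> ('a, 'k) mpoly" where
  "linear_form = (SOME L. Vector_Spaces.linear sc poly_scale L
    \<and> (\<forall>b\<in>B. L b = pvar b) \<and> (\<forall>v\<in>F. L v = 0))"

lemma linear_linear_form: "Vector_Spaces.linear sc poly_scale linear_form"
  and linear_form_basis: "b \<in> B \<Longrightarrow> linear_form b = pvar b"
  and linear_form_F: "v \<in> F \<Longrightarrow> linear_form v = 0"
proof -
  interpret vector_space_pair sc "poly_scale :: 'k \<Rightarrow> ('a, 'k) mpoly \<Rightarrow> _"
    by unfold_locales
  have "\<exists>L. Vector_Spaces.linear sc poly_scale L \<and> (\<forall>b\<in>B. L b = pvar b) \<and> (\<forall>v\<in>F. L v = 0)"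
    by (rule exists_linear_vanishing_extend [OF basis module_subspace])
  then have "Vector_Spaces.linear sc poly_scale linear_form
      \<and> (\<forall>b\<in>B. linear_form b = pvar b) \<and> (\<forall>v\<in>F. linear_form v = 0)"
    unfolding linear_form_def by (rule someI_ex)
  then show "Vector_Spaces.linear sc poly_scale linear_form"
    and "b \<in> B \<Longrightarrow> linear_form b = pvar b" and "v \<in> F \<Longrightarrow> linear_form v = 0"
    by simp_all
qed

sublocale linear_form: Vector_Spaces.linear sc poly_scale linear_form
  by (rule linear_linear_form)

lemma linear_form_in_linear_forms:
  assumes "a \<in> A"
  shows "linear_form a \<in> linear_forms B"
proof -
  have "linear_form ` A \<subseteq> mpoly.span (linear_form ` (B \<union> F))"
    by (rule linear_form.spans_image [OF carrier_subset_span])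
  also have "\<dots> \<subseteq> mpoly.span (insert 0 (pvar ` B))"
    by (rule mpoly.span_mono) (auto simp: linear_form_basis linear_form_F)
  finally show ?thesis
    using assms by (auto simp: linear_forms_eq_span)
qed

lemma linear_form_in_R: "a \<in> A \<Longrightarrow> linear_form a \<in> R"
  using linear_form_in_linear_forms linear_forms_subset_polys_in by blast

lemma linear_form_eq_0D:
  assumes "linear_form a = 0" "a \<in> A"
  shows "a \<in> F"
proof -
  have "a \<in> span (B \<union> F)" and span_F: "span F = F"
    using assms(2) carrier_subset_span module_subspace by auto
  then obtain s t where st: "a = s + t" "s \<in> span B" "t \<in> F"
    unfolding span_Un span_F by blast
  have "linear_form ` B = pvar ` B"
    by (simp add: linear_form_basis)
  then have "mpoly.independent (linear_form ` B)"
    by (simp add: independent_pvar)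
  moreover have "inj_on linear_form B"
    by (rule inj_onI) (simp add: linear_form_basis inj_eq [OF inj_pvar])
  ultimately have "inj_on linear_form (span B)"
    by (rule linear_form.inj_on_span_independent_image)
  moreover have "linear_form s = 0"
    using assms(1) st(1,3) by (simp add: linear_form.add linear_form_F)
  ultimately have "s = 0"
    using linear_form.inj_on_iff_eq_0 [OF subspace_span] st(2) by blast
  with st show ?thesis
    by simp
qed

lemma act_linear_form:
  assumes v: "v \<in> F" and "a \<in> A"
  shows "act v (linear_form a) = br v a"
proof -
  have vA: "v \<in> A"
    using v F_subset by blast
  have "subspace {a \<in> A. act v (linear_form a) = br v a}"
    by (rule subspaceI)
      (auto simp: v vA carrier_0 carrier_add carrier_scale linear_form_in_R linear_form.add
        linear_form.scale act_0_right act_add_right act_pconst_mult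
        br_0_right br_add_right br_scale_right)
  moreover have "B \<union> F \<subseteq> {a \<in> A. act v (linear_form a) = br v a}"
    using v abelian B_subset F_subset
    by (auto simp: linear_form_basis linear_form_F act_pvar act_0_right abelian_set_def)
  ultimately show ?thesis
    using span_minimal carrier_subset_span \<open>a \<in> A\<close> by blast
qed

lemma lie_ideal_act_span:
  assumes "G \<subseteq> F"
  shows "lie_ideal sc br A (act_span G)"
  unfolding lie_ideal_def
proof (intro conjI ballI)
  show "act_span G \<subseteq> A"
    using act_span_subset [OF assms] F_subset by blast
  show "br v a \<in> act_span G" if "v \<in> act_span G" "a \<in> A" for v a
    using act_span_act [OF assms that(1) linear_form_in_R [OF that(2)]]
      act_linear_form [OF _ that(2)] act_span_subset [OF assms] that(1) by auto
qed (rule act_span_subspace [OF assms])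

lemma lie_derivation_act:
  assumes D: "lie_derivation sc br A D" "D ` A \<subseteq> F" and "x \<in> A" "y \<in> A"
  shows "D (br x y) + act (D y) (linear_form x) = act (D x) (linear_form y)"
proof -
  have "D x \<in> F" "D y \<in> F"
    using assms by auto
  then show ?thesis
    using assms br_anti [of "D y" x] by (simp add: lie_derivation_def act_linear_form)
qed

lemma lookup_free_embedding_derivation_br:
  assumes D: "lie_derivation sc br A D" "D ` A \<subseteq> act_span G" and G: "G \<subseteq> F"
    and \<psi>: "free_embedding (act_span G) \<psi>" and xy: "x \<in> A" "y \<in> A"
  shows "Poly_Mapping.lookup (\<psi> (D (br x y))) i = Poly_Mapping.lookup (\<psi> (D x)) i * linear_form y
    - Poly_Mapping.lookup (\<psi> (D y)) i * linear_form x"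
proof -
  have D_span: "D a \<in> act_span G" if "a \<in> A" for a
    using that D(2) by auto
  have "D ` A \<subseteq> F"
    using D(2) act_span_subset [OF G] by (rule order_trans)
  then have "\<psi> (D (br x y)) + \<psi> (act (D y) (linear_form x)) = \<psi> (act (D x) (linear_form y))"
    using xy lie_derivation_act [OF D(1) _ xy]
    by (simp add: D_span br_closed act_span_act G linear_form_in_R flip: free_embeddingD(2) [OF \<psi>])
  then have "Poly_Mapping.lookup (\<psi> (D (br x y))) i
      + Poly_Mapping.lookup (\<psi> (D y)) i * linear_form x
      = Poly_Mapping.lookup (\<psi> (D x)) i * linear_form y"
    using xy by (simp add: D_span linear_form_in_R flip: free_embeddingD(3) [OF \<psi>] lookup_add)
  then show ?thesis
    by (simp add: eq_diff_eq)
qed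

lemma
  assumes D: "lie_derivation sc br A D" "D ` A \<subseteq> act_span G" "\<forall>a\<in>F. D a = 0 \<longrightarrow> a = 0"
    and G: "G \<subseteq> F" and \<psi>: "free_embedding (act_span G) \<psi>"
  defines "\<phi> \<equiv> \<lambda>a. (linear_form a, \<psi> (D a))"
  shows lie_embedding_of_derivation: "lie_embedding sc br A mat_scale mat_br \<phi>"
    and image_embedding_of_derivation: "\<phi> ` A \<subseteq> matM0 UNIV B"
proof -
  have D_span: "D a \<in> act_span G" and D_F: "D a \<in> F" if "a \<in> A" for a
    using that D(2) act_span_subset [OF G] by auto
  show "lie_embedding sc br A mat_scale mat_br \<phi>"
  proof (rule lie_embeddingI)
    show "\<phi> (x + y) = \<phi> x + \<phi> y" if "x \<in> A" "y \<in> A" for x y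
      using that D(1) by (simp add: \<phi>_def lie_derivation_def linear_form.add D_span
          free_embeddingD(2) [OF \<psi>])
    show "\<phi> (sc c x) = mat_scale c (\<phi> x)" if "x \<in> A" for c x
    proof (rule mat_eqI)
      have "D (sc c x) = act (D x) (pconst c)"
        using D(1) that by (simp add: lie_derivation_def act_pconst D_F)
      then show "Poly_Mapping.lookup (snd (\<phi> (sc c x))) i
          = Poly_Mapping.lookup (snd (mat_scale c (\<phi> x))) i" for i
        using that by (simp add: \<phi>_def D_span free_embeddingD(3) [OF \<psi>] mult.commute)
    qed (simp add: \<phi>_def linear_form.scale)
    show "\<phi> (br x y) = mat_br (\<phi> x) (\<phi> y)" if xy: "x \<in> A" "y \<in> A" for x y
    proof (rule mat_eqI)
      show "fst (\<phi> (br x y)) = fst (mat_br (\<phi> x) (\<phi> y))"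
        using xy by (simp add: \<phi>_def linear_form_F br_in_F)
      show "Poly_Mapping.lookup (snd (\<phi> (br x y))) i
          = Poly_Mapping.lookup (snd (mat_br (\<phi> x) (\<phi> y))) i" for i
        by (simp add: \<phi>_def lookup_free_embedding_derivation_br [OF D(1,2) G \<psi> xy])
    qed
    show "x = 0" if "x \<in> A" "\<phi> x = 0" for x
      using that linear_form_eq_0D D(3) D_span free_embeddingD(4) [OF \<psi>]
      by (auto simp: \<phi>_def zero_prod_def)
  qed
  show "\<phi> ` A \<subseteq> matM0 UNIV B"
    using linear_form_in_linear_forms free_embeddingD(1) [OF \<psi>] D_span
    by (auto simp: \<phi>_def matM0_iff)
qed

lemma
  assumes "B = {}" and X: "finite X" "X \<subseteq> A" "lie_generated sc br A X = A"
  shows carrier_eq_F_if_basis_empty: "A = F"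
    and carrier_subset_act_span_if_basis_empty: "A \<subseteq> act_span X"
proof -
  show "A = F"
    using \<open>B = {}\<close> carrier_subset_span F_subset module_subspace
    by (metis Un_empty_left span_eq_iff subset_antisym)
  then have XF: "X \<subseteq> F"
    using X(2) by simp
  have "br x y \<in> act_span X" if "x \<in> X" "y \<in> X" for x y
    using that XF abelian subspace_0 [OF act_span_subspace [OF XF]]
    by (auto simp: abelian_set_def subset_iff)
  then have "A \<subseteq> span (X \<union> act_span X)"
    by (rule carrier_subset_span_generators [OF lie_ideal_act_span [OF XF] X(2,3)])
  also have "\<dots> \<subseteq> act_span X"
    using act_span_base [OF X(1) XF] by (intro span_minimal act_span_subspace XF) blast
  finally show "A \<subseteq> act_span X" .
qed

lemma brackets_in_act_span:
  assumes X: "finite X" "X \<subseteq> A" "lie_generated sc br A X = A"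
  obtains G where "finite G" "G \<subseteq> F" "\<forall>a\<in>A. \<forall>b\<in>A. br a b \<in> act_span G"
proof
  let ?G = "(\<lambda>(x, y). br x y) ` (X \<times> X)"
  show G: "finite ?G" "?G \<subseteq> F"
    using X(1,2) br_in_F by auto
  have "br x y \<in> act_span ?G" if "x \<in> X" "y \<in> X" for x y
    using that by (intro act_span_base G) auto
  then show "\<forall>a\<in>A. \<forall>b\<in>A. br a b \<in> act_span ?G"
    using br_in_ideal_of_generators [OF lie_ideal_act_span [OF G(2)] X(2,3)] by blast
qed

lemma exists_injective_derivation:
  assumes X: "finite X" "X \<subseteq> A" "lie_generated sc br A X = A"
  obtains G D where "finite G" "G \<subseteq> F" "lie_derivation sc br A D"
    "D ` A \<subseteq> act_span G" "\<forall>a\<in>F. D a = 0 \<longrightarrow> a = 0"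
proof (cases "B = {}")
  case True
  note AF = carrier_eq_F_if_basis_empty [OF True X]
  have "lie_derivation sc br A (\<lambda>a. a)"
    using abelian by (simp add: lie_derivation_def abelian_set_def AF)
  then show thesis
    using X(1,2) AF carrier_subset_act_span_if_basis_empty [OF True X]
    by (intro that [of X "\<lambda>a. a"]) auto
next
  case False
  then obtain b where b: "b \<in> B" "b \<in> A"
    using B_subset by blast
  obtain G where G: "finite G" "G \<subseteq> F" and br_G: "\<forall>a\<in>A. \<forall>b\<in>A. br a b \<in> act_span G"
    by (rule brackets_in_act_span [OF X])
  have "a = 0" if "a \<in> F" "br a b = 0" for a
  proof (rule act_eq_0D [of a "pvar b"])
    show "act a (pvar b) = 0"
      using that b(1) by (simp add: act_pvar)
    show "(pvar b :: ('a, 'k) mpoly) \<noteq> 0"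
      using lookup_pvar [of b b, where 'a = 'k] by auto
  qed (use that b in simp_all)
  then show thesis
    using br_G b(2) by (intro that [OF G lie_derivation_inner [OF b(2)]]) auto
qed

theorem exists_matrix_embedding:
  assumes X: "finite X" "X \<subseteq> A" "lie_generated sc br A X = A"
  shows "\<exists>(I :: nat set) (\<Lambda> :: nat set) (\<phi> :: 'a \<Rightarrow> (nat, nat, 'k) mat_elem).
    lie_embedding sc br A mat_scale mat_br \<phi> \<and> \<phi> ` A \<subseteq> matM0 I \<Lambda>"
proof -
  obtain G D where G: "finite G" "G \<subseteq> F" and D: "lie_derivation sc br A D"
      "D ` A \<subseteq> act_span G" "\<forall>a\<in>F. D a = 0 \<longrightarrow> a = 0"
    by (rule exists_injective_derivation [OF X])
  obtain \<psi> :: "'a \<Rightarrow> nat \<Rightarrow>\<^sub>0 ('a, 'k) mpoly" where \<psi>: "free_embedding (act_span G) \<psi>"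
    using exists_free_embedding [OF G] by blast
  define \<phi> where "\<phi> a = (linear_form a, \<psi> (D a))" for a
  have \<phi>: "lie_embedding sc br A mat_scale mat_br \<phi>" "\<phi> ` A \<subseteq> matM0 UNIV B"
    unfolding \<phi>_def
    by (fact lie_embedding_of_derivation [OF D G(2) \<psi>],
        fact image_embedding_of_derivation [OF D G(2) \<psi>])
  have "A \<subseteq> span (X \<union> F)"
    by (rule carrier_subset_span_generators [OF ideal X(2,3)]) (use br_in_F X(2) in auto)
  then have "finite B"
    by (rule finite_quotient_basis [OF basis module_subspace X(1)])
  then obtain h :: "'a \<Rightarrow> nat" where "inj_on h B"
    using finite_imp_inj_to_nat_seg by blast
  define ren :: "(nat, 'a, 'k) mat_elem \<Rightarrow> (nat, nat, 'k) mat_elem"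
    where "ren = mat_subst (\<lambda>b. pvar (h b))"
  have "lie_embedding mat_scale mat_br (matM UNIV B) mat_scale mat_br ren"
    unfolding ren_def
    by (rule lie_embedding_mat_subst [OF inj_on_poly_subst_rename [OF \<open>inj_on h B\<close>]])
  moreover have "\<phi> ` A \<subseteq> matM UNIV B"
    using \<phi>(2) by (auto simp: matM0_def)
  ultimately have "lie_embedding sc br A mat_scale mat_br (ren \<circ> \<phi>)"
    using lie_embedding_comp [OF \<phi>(1)] by blast
  moreover have "(ren \<circ> \<phi>) ` A \<subseteq> matM0 UNIV (h ` B)"
    using \<phi>(2) by (auto simp: ren_def intro!: mat_subst_rename_matM0)
  ultimately show ?thesis
    by blast
qed

end

theorem U_algebra_matrix_embedding:
  fixes sc :: "'k::field \<Rightarrow> 'a::ab_group_add \<Rightarrow> 'a"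
  assumes "finitely_generated sc br A" and U: "U_algebra sc br A"
  shows "\<exists>(I :: nat set) (\<Lambda> :: nat set) (\<phi> :: 'a \<Rightarrow> (nat, nat, 'k) mat_elem).
    lie_embedding sc br A mat_scale mat_br \<phi> \<and> \<phi> ` A \<subseteq> matM0 I \<Lambda>"
proof -
  let ?F = "fitting sc br A"
  obtain X where X: "finite X" "X \<subseteq> A" "lie_generated sc br A X = A"
    using assms(1) unfolding finitely_generated_def by blast
  obtain B act where B: "quotient_basis sc A ?F B" and act: "poly_action sc br ?F B act"
    and torsion_free: "torsion_free_action ?F B act"
    using U unfolding U_algebra_def by blast
  have metabelian: "metabelian sc br A" and abelian: "abelian_set br ?F"
    using U by (simp_all add: U_algebra_def)
  interpret lie_algebra_on sc br A
    by unfold_locales (use metabelian in \<open>simp add: metabelian_def\<close>)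
  interpret torsion_free_extension sc br A ?F B act
    using lie_ideal_fitting abelian br_in_fitting [OF metabelian] B act torsion_free
    by unfold_locales (simp_all add: lie_ideal_def)
  show ?thesis
    by (rule exists_matrix_embedding [OF X])
qed

theorem theorem3p2p1:
  shows "(\<forall>(sc :: 'k::field \<Rightarrow> 'a::ab_group_add \<Rightarrow> 'a) br A.
            finitely_generated sc br A \<and> U_algebra sc br A \<longrightarrow>
            (\<exists>(I :: nat set) (\<Lambda> :: nat set) (\<phi> :: 'a \<Rightarrow> (nat, nat, 'k) mat_elem).
               lie_embedding sc br A mat_scale mat_br \<phi> \<and> \<phi> ` A \<subseteq> matM0 I \<Lambda>))
       \<and> (\<forall>(I :: 'i set) (\<Lambda> :: 'l set) (T :: ('i, 'l, 'k) mat_elem set).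
            lie_subalgebra mat_scale mat_br (matM0 I \<Lambda>) T \<longrightarrow> U_algebra mat_scale mat_br T)"
proof (intro conjI allI impI)
  fix sc :: "'k \<Rightarrow> 'a \<Rightarrow> 'a" and br A
  assume "finitely_generated sc br A \<and> U_algebra sc br A"
  then show "\<exists>(I :: nat set) (\<Lambda> :: nat set) (\<phi> :: 'a \<Rightarrow> (nat, nat, 'k) mat_elem).
      lie_embedding sc br A mat_scale mat_br \<phi> \<and> \<phi> ` A \<subseteq> matM0 I \<Lambda>"
    using U_algebra_matrix_embedding by blast
qed (rule U_algebra_subalgebra_matM0)

end
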